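(* Let $X$ be a compact length space with $\operatorname{diam}(X)>0$ which admits a universal cover $\rho:\widetilde X\to X$, and suppose $\pi_1(X)$ is finite of order $n$ (so $\rho$ is an $n$-fold covering). Equip $\widetilde X$ with the lifted length metric. Then $\operatorname{diam}(\widetilde X)<4\sqrt{n}\,\operatorname{diam}(X)$.
   Context: The lifted length metric on $\widetilde X$ is the unique length structure on $\widetilde X$ such that for every curve $\gamma:[0,1]\to\widetilde X$ one has $\ell(\gamma)=\ell(\rho\circ\gamma)$, where $\ell$ denotes length; distances in $\widetilde X$ are infima of lengths of curves joining the points. *)

theory Defs
  imports "HOL-Analysis.Analysis"
begin

definition curve_length :: "(real \<Rightarrow> 'a::metric_space) \<Rightarrow> ereal" where
  "curve_length g =
     (SUP ts \<in> {ts. sorted ts \<and> set ts \<subseteq> {0..1}}.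
        ereal (\<Sum>i < length ts - 1. dist (g (ts ! i)) (g (ts ! (i + 1)))))"

definition curves_between :: "'a::topological_space set \<Rightarrow> 'a \<Rightarrow> 'a \<Rightarrow> (real \<Rightarrow> 'a) set" where
  "curves_between S x y =
     {g. path g \<and> path_image g \<subseteq> S \<and> pathstart g = x \<and> pathfinish g = y}"

definition length_space :: "'a::metric_space set \<Rightarrow> bool" where
  "length_space X \<longleftrightarrow>
     (\<forall>x\<in>X. \<forall>y\<in>X. ereal (dist x y) = (INF g \<in> curves_between X x y. curve_length g))"

definition universal_cover ::
    "'b::topological_space set \<Rightarrow> ('b \<Rightarrow> 'a::topological_space) \<Rightarrow> 'a set \<Rightarrow> bool" where
  "universal_cover Xt \<rho> X \<longleftrightarrow>
     covering_space Xt \<rho> X \<and> path_connected Xt \<and> simply_connected Xt"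

definition fundamental_group_set :: "'a::topological_space set \<Rightarrow> 'a \<Rightarrow> (real \<Rightarrow> 'a) set set" where
  "fundamental_group_set X x0 =
     (\<lambda>p. {q. homotopic_paths X p q}) ` curves_between X x0 x0"

definition lifted_dist ::
    "'b::topological_space set \<Rightarrow> ('b \<Rightarrow> 'a::metric_space) \<Rightarrow> 'b \<Rightarrow> 'b \<Rightarrow> ereal" where
  "lifted_dist Xt \<rho> p q = (INF g \<in> curves_between Xt p q. curve_length (\<rho> \<circ> g))"

definition lifted_diameter ::
    "'b::topological_space set \<Rightarrow> ('b \<Rightarrow> 'a::metric_space) \<Rightarrow> ereal" where
  "lifted_diameter Xt \<rho> = (SUP (p, q) \<in> Xt \<times> Xt. lifted_dist Xt \<rho> p q)"

end

theory Submission
  imports Defs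
begin

text \<open>
  Write \<open>D\<close> for the diameter of \<open>X\<close> and let \<open>a\<close>, \<open>b\<close> be points of one fibre \<open>F\<close> at distance \<open>L\<close>;
  every point of the cover is within about \<open>D\<close> of \<open>F\<close>. Cut the cover by the thin slabs
  \<open>A = {t \<le> d a y \<le> t + \<delta>}\<close> at the levels \<open>t \<approx> 2 D j\<close>, and split a slab into pieces, one for each class of
  points of \<open>F\<close> under the relation that their \<open>D\<close>-balls overlap inside \<open>A\<close>.
  Simple connectedness forces a single piece to separate \<open>a\<close> from \<open>b\<close>: counting crossings of a piece
  is homotopy invariant, and the crossing numbers of all pieces add up to 1.
  If the corresponding class has \<open>k\<close> points, the piece lies in a path connected set \<open>S\<close> of size about
  \<open>2 D k\<close> that still separates. When \<open>2 D k\<close> is less than both \<open>t\<close> and \<open>L - t\<close>, deck transformations move \<open>S\<close> off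
  itself, close to \<open>a\<close> or to \<open>b\<close>. The translate cuts off a region strictly inside a component
  of the complement of \<open>S\<close>; choosing the side with fewer points of \<open>F\<close> gives a contradiction.
  So the level \<open>j\<close> carries at least \<open>min (j + 1) (M - j)\<close> points of \<open>F\<close>, where \<open>M \<approx> L / (2 D)\<close>, and distinct
  levels use distinct points. Summing gives \<open>M (M + 2) \<le> 4 n\<close>.
\<close>

section \<open>Lifting through covering maps\<close>

text \<open>The set where two lifts agree is open and closed in the connected set \<open>T\<close>.
  Near a point both lifts stay in sheets over one evenly covered set: in a common sheet they agree
  because \<open>p\<close> is injective there, in different sheets they differ because sheets are
  disjoint.\<close>

lemma covering_lift_unique:
  fixes k1 k2 :: "'c::topological_space \<Rightarrow> 'b::topological_space"
  assumes cov: "covering_space C p S"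
    and T: "connected T" "a \<in> T" "x \<in> T"
    and k1: "continuous_on T k1" "k1 ` T \<subseteq> C"
    and k2: "continuous_on T k2" "k2 ` T \<subseteq> C"
    and eq: "\<And>x. x \<in> T \<Longrightarrow> p (k1 x) = p (k2 x)"
    and a: "k1 a = k2 a"
  shows "k1 x = k2 x"
proof -
  define E where "E = {x\<in>T. k1 x = k2 x}"
  have loc: "\<exists>O'. openin (top_of_set T) O' \<and> x \<in> O' \<and> (if k1 x = k2 x then O' \<subseteq> E else O' \<subseteq> T - E)"
    if x: "x \<in> T" for x
  proof -
    have "p (k1 x) \<in> S"
      using covering_space_imp_surjective[OF cov] k1 x by blast
    then obtain U v where U: "p (k1 x) \<in> U" and v: "\<Union>v = C \<inter> p -` U"
      "\<And>u. u \<in> v \<Longrightarrow> openin (top_of_set C) u" "pairwise disjnt v"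
      "\<And>u. u \<in> v \<Longrightarrow> \<exists>q. homeomorphism u U p q"
      using cov unfolding covering_space_def by metis
    have "k1 x \<in> \<Union>v" "k2 x \<in> \<Union>v"
      using U x k1 k2 eq[OF x] unfolding v by auto
    then obtain u1 u2 where u: "u1 \<in> v" "k1 x \<in> u1" "u2 \<in> v" "k2 x \<in> u2" by blast
    have disj: "u1 \<inter> u2 = {}" if "u1 \<noteq> u2"
      using v(3) u that unfolding pairwise_def disjnt_def by blast
    let ?O = "(T \<inter> k1 -` u1) \<inter> (T \<inter> k2 -` u2)"
    have "openin (top_of_set T) ?O"
      using u v k1 k2 by (intro openin_Int continuous_openin_preimage[where T = C]) (auto simp: Pi_iff)
    moreover have "?O \<subseteq> E" if "u1 = u2"
    proof -
      obtain q where "homeomorphism u1 U p q" using v u by blast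
      then have "inj_on p u1" by (metis homeomorphism_def inj_on_def)
      then show ?thesis using that eq unfolding E_def inj_on_def by auto
    qed
    moreover have "?O \<subseteq> T - E" if "u1 \<noteq> u2"
      using disj[OF that] unfolding E_def by auto
    moreover have "u1 = u2" if "k1 x = k2 x"
      using disj u that by auto
    moreover have "u1 \<noteq> u2" if "k1 x \<noteq> k2 x"
    proof
      assume "u1 = u2"
      then have "x \<in> E" using \<open>u1 = u2 \<Longrightarrow> ?O \<subseteq> E\<close> u x by auto
      then show False using that by (simp add: E_def)
    qed
    ultimately show ?thesis using u x by (intro exI[of _ ?O]) auto
  qed
  have 1: "openin (top_of_set T) E"
  proof (subst openin_subopen, intro ballI)
    fix x assume "x \<in> E"
    then show "\<exists>O'. openin (top_of_set T) O' \<and> x \<in> O' \<and> O' \<subseteq> E"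
      using loc[of x] by (simp add: E_def)
  qed
  have 2: "openin (top_of_set T) (T - E)"
  proof (subst openin_subopen, intro ballI)
    fix x assume "x \<in> T - E"
    then show "\<exists>O'. openin (top_of_set T) O' \<and> x \<in> O' \<and> O' \<subseteq> T - E"
      using loc[of x] by (simp add: E_def)
  qed
  have "E = {} \<or> E = T"
    using 1 2 T(1) by (simp add: connected_clopen closedin_def openin_imp_subset)
  then show ?thesis using T a by (auto simp: E_def)
qed

text \<open>Lifts are demanded through every starting point \<open>z\<close> and every point of
  \<open>C\<close> over \<open>h z\<close>. This strength lets the property pass to unions, and so
  through bisection.\<close>

definition lifts_on :: "'b::topological_space set \<Rightarrow> ('b \<Rightarrow> 'a) \<Rightarrow> ('c::topological_space \<Rightarrow> 'a) \<Rightarrow> 'c set \<Rightarrow> bool"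
  where "lifts_on C p h R \<longleftrightarrow>
    (\<forall>z\<in>R. \<forall>a\<in>C. p a = h z \<longrightarrow>
      (\<exists>k. continuous_on R k \<and> k ` R \<subseteq> C \<and> (\<forall>x\<in>R. p (k x) = h x) \<and> k z = a))"

text \<open>A lift on one piece prescribes a value at a point \<open>w\<close> of the overlap, and
  the other piece is lifted from there. Uniqueness on the connected overlap makes the two lifts
  agree, and closedness of the pieces makes the glued map continuous.\<close>

lemma lifts_on_Un:
  assumes cov: "covering_space C p S"
    and R: "closed R1" "closed R2" "connected (R1 \<inter> R2)" "R1 \<inter> R2 \<noteq> {}"
    and l1: "lifts_on C p h R1" and l2: "lifts_on C p h R2"
  shows "lifts_on C p h (R1 \<union> R2)"
proof -
  have *: "\<exists>k. continuous_on (A \<union> B) k \<and> k ` (A \<union> B) \<subseteq> C \<and> (\<forall>x\<in>A \<union> B. p (k x) = h x) \<and> k z = a"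
    if lA: "lifts_on C p h A" and lB: "lifts_on C p h B" and cl: "closed A" "closed B"
      and con: "connected (A \<inter> B)" "A \<inter> B \<noteq> {}" and z: "z \<in> A" and a: "a \<in> C" "p a = h z" for A B z a
  proof -
    obtain k where k: "continuous_on A k" "k ` A \<subseteq> C" "\<forall>x\<in>A. p (k x) = h x" "k z = a"
      using lA z a unfolding lifts_on_def by metis
    obtain w where w: "w \<in> A" "w \<in> B" using con by blast
    obtain l where l: "continuous_on B l" "l ` B \<subseteq> C" "\<forall>x\<in>B. p (l x) = h x" "l w = k w"
      using lB w k unfolding lifts_on_def by (metis image_subset_iff)
    have agree: "k x = l x" if "x \<in> A" "x \<in> B" for x
      by (rule covering_lift_unique[OF cov con(1), of w x k l])
         (use k l w that in \<open>auto intro: continuous_on_subset\<close>)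
    show ?thesis
    proof (intro exI[of _ "\<lambda>x. if x \<in> A then k x else l x"] conjI)
      show "continuous_on (A \<union> B) (\<lambda>x. if x \<in> A then k x else l x)"
        by (rule continuous_on_cases) (use cl k l agree in auto)
    qed (use k l z in auto)
  qed
  show ?thesis
    unfolding lifts_on_def
  proof (intro ballI impI)
    fix z a assume "z \<in> R1 \<union> R2" "a \<in> C" "p a = h z"
    then show "\<exists>k. continuous_on (R1 \<union> R2) k \<and> k ` (R1 \<union> R2) \<subseteq> C \<and> (\<forall>x\<in>R1 \<union> R2. p (k x) = h x) \<and> k z = a"
      using *[OF l1 l2 R, of z a] *[OF l2 l1 R(2,1), of z a] R(3,4)
      by (auto simp: Un_commute Int_commute)
  qed
qed

lemma lifts_on_evenly_covered:
  assumes h: "continuous_on R h"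
    and T: "h ` R \<subseteq> T" "\<Union>v = C \<inter> p -` T" "\<And>u. u \<in> v \<Longrightarrow> \<exists>q. homeomorphism u T p q"
  shows "lifts_on C p h R"
  unfolding lifts_on_def
proof (intro ballI impI)
  fix z a assume za: "z \<in> R" "a \<in> C" "p a = h z"
  then have "a \<in> \<Union>v" using T by auto
  then obtain u q where u: "u \<in> v" "a \<in> u" and q: "homeomorphism u T p q" using T by blast
  have "u \<subseteq> C" using T(2) u by blast
  show "\<exists>k. continuous_on R k \<and> k ` R \<subseteq> C \<and> (\<forall>x\<in>R. p (k x) = h x) \<and> k z = a"
  proof (intro exI[of _ "q \<circ> h"] conjI)
    show "continuous_on R (q \<circ> h)"
      using q T h by (intro continuous_on_compose) (auto simp: homeomorphism_def intro: continuous_on_subset)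
    have "q ` T = u" "\<And>y. y \<in> T \<Longrightarrow> p (q y) = y" "\<And>y. y \<in> u \<Longrightarrow> q (p y) = y"
      using q by (auto simp: homeomorphism_def)
    then show "(q \<circ> h) ` R \<subseteq> C" "\<forall>x\<in>R. p ((q \<circ> h) x) = h x" "(q \<circ> h) z = a"
      using T(1) \<open>u \<subseteq> C\<close> u za(3)[symmetric] by (auto simp: image_subset_iff)
  qed
qed

text \<open>Small rectangles map into an evenly covered set. One bisection glues them to thin
  strips, a second glues strips to the square. With \<open>h\<close> given on the whole plane,
  rectangles may stick out of the square.\<close>

lemma lifts_on_square:
  fixes h :: "real \<times> real \<Rightarrow> 'a::topological_space"
  assumes cov: "covering_space C p S" and h: "continuous_on UNIV h" "range h \<subseteq> S"
  shows "lifts_on C p h ({0..1} \<times> {0..1})"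
proof -
  have small: "\<exists>d>0. \<forall>a b a' b'. a \<le> s \<and> s \<le> b \<and> b - a < d \<and> a' \<le> t \<and> t \<le> b' \<and> b' - a' < d
      \<longrightarrow> lifts_on C p h ({a..b} \<times> {a'..b'})" for s t
  proof -
    have "h (s, t) \<in> S" using h by auto
    then obtain T v where T: "h (s, t) \<in> T" "openin (top_of_set S) T" and v: "\<Union>v = C \<inter> p -` T"
      "\<And>u. u \<in> v \<Longrightarrow> \<exists>q. homeomorphism u T p q"
      using cov unfolding covering_space_def by metis
    have "openin (top_of_set UNIV) (UNIV \<inter> h -` T)"
      by (rule continuous_openin_preimage[OF h(1) _ T(2)]) (use h in auto)
    then have "open (h -` T)" by simp
    moreover have "(s, t) \<in> h -` T" using T by simp
    ultimately obtain e where e: "e > 0" "ball (s, t) e \<subseteq> h -` T" by (meson openE)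
    show ?thesis
    proof (intro exI[of _ "e/2"] conjI allI impI)
      fix a b a' b' assume *: "a \<le> s \<and> s \<le> b \<and> b - a < e/2 \<and> a' \<le> t \<and> t \<le> b' \<and> b' - a' < e/2"
      have "{a..b} \<times> {a'..b'} \<subseteq> ball (s, t) e"
      proof clarify
        fix x y assume "x \<in> {a..b}" "y \<in> {a'..b'}"
        then have "\<bar>s - x\<bar> < e/2" "\<bar>t - y\<bar> < e/2"
          using * unfolding atLeastAtMost_iff by linarith+
        moreover have "dist (s, t) (x, y) \<le> \<bar>s - x\<bar> + \<bar>t - y\<bar>"
          using sqrt_sum_squares_le_sum_abs[of "s - x" "t - y"] by (simp add: dist_Pair_Pair dist_real_def)
        ultimately show "(x, y) \<in> ball (s, t) e" by simp
      qed
      with e show "lifts_on C p h ({a..b} \<times> {a'..b'})"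
        by (intro lifts_on_evenly_covered[OF _ _ v, of _ h]) (auto intro: continuous_on_subset[OF h(1)])
    qed (use e in auto)
  qed
  have strip: "\<exists>d>0. \<forall>a b. a \<le> s \<and> s \<le> b \<and> b - a < d \<longrightarrow> lifts_on C p h ({a..b} \<times> {0..1})" for s
  proof -
    define P where "P x y \<longleftrightarrow> (\<exists>d>0. \<forall>a b. a \<le> s \<and> s \<le> b \<and> b - a < d \<longrightarrow> lifts_on C p h ({a..b} \<times> {x..y}))" for x y
    have "P 0 1"
    proof (rule Bolzano)
      fix x y z :: real assume P: "P x y" "P y z" and xyz: "x \<le> y" "y \<le> z"
      obtain d1 where d1: "d1 > 0"
        "\<And>a b. a \<le> s \<and> s \<le> b \<and> b - a < d1 \<Longrightarrow> lifts_on C p h ({a..b} \<times> {x..y})"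
        using P(1) unfolding P_def by auto
      obtain d2 where d2: "d2 > 0"
        "\<And>a b. a \<le> s \<and> s \<le> b \<and> b - a < d2 \<Longrightarrow> lifts_on C p h ({a..b} \<times> {y..z})"
        using P(2) unfolding P_def by auto
      show "P x z"
        unfolding P_def
      proof (intro exI[of _ "min d1 d2"] conjI allI impI)
        fix a b assume *: "a \<le> s \<and> s \<le> b \<and> b - a < min d1 d2"
        have i: "({a..b} \<times> {x..y}) \<inter> ({a..b} \<times> {y..z}) = {a..b} \<times> {y}"
          and u: "({a..b} \<times> {x..y}) \<union> ({a..b} \<times> {y..z}) = {a..b} \<times> {x..z}" using xyz by auto
        show "lifts_on C p h ({a..b} \<times> {x..z})"
          unfolding u[symmetric]
        proof (rule lifts_on_Un[OF cov])
          show "lifts_on C p h ({a..b} \<times> {x..y})" "lifts_on C p h ({a..b} \<times> {y..z})"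
            using * by (intro d1 d2; simp)+
          show "({a..b} \<times> {x..y}) \<inter> ({a..b} \<times> {y..z}) \<noteq> {}"
            using * unfolding i by auto
        qed (auto simp: i closed_Times connected_Times)
      qed (use d1 d2 in auto)
    next
      fix t :: real
      obtain d where "d > 0" and d: "\<And>a b a' b'. a \<le> s \<and> s \<le> b \<and> b - a < d \<and> a' \<le> t \<and> t \<le> b' \<and> b' - a' < d
          \<Longrightarrow> lifts_on C p h ({a..b} \<times> {a'..b'})"
        using small[of s t] by auto
      then show "\<exists>d>0. \<forall>a b. a \<le> t \<and> t \<le> b \<and> b - a < d \<longrightarrow> P a b"
        unfolding P_def by (intro exI[of _ d] conjI allI impI d) auto
    qed simp
    then show ?thesis unfolding P_def .
  qed
  show ?thesis
  proof (rule Bolzano[where P = "\<lambda>x y. lifts_on C p h ({x..y} \<times> {0..1})"])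
    fix x y z :: real
    assume l: "lifts_on C p h ({x..y} \<times> {0..1})" "lifts_on C p h ({y..z} \<times> {0..1})" and xyz: "x \<le> y" "y \<le> z"
    have i: "({x..y} \<times> {0..1}) \<inter> ({y..z} \<times> {0..1}) = {y} \<times> {0..1::real}"
      and u: "({x..y} \<times> {0..1}) \<union> ({y..z} \<times> {0..1}) = {x..z} \<times> {0..1::real}" using xyz by auto
    show "lifts_on C p h ({x..z} \<times> {0..1})"
      unfolding u[symmetric]
      by (rule lifts_on_Un[OF cov _ _ _ _ l]) (simp_all add: i closed_Times connected_Times)
  qed (use strip in simp_all)
qed

lemma covering_lift_square:
  fixes h :: "real \<times> real \<Rightarrow> 'a::topological_space"
  assumes cov: "covering_space C p S"
    and h: "continuous_on ({0..1} \<times> {0..1}) h" "h ` ({0..1} \<times> {0..1}) \<subseteq> S"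
    and a: "a \<in> C" "p a = h (0, 0)"
  obtains k where "continuous_on ({0..1} \<times> {0..1}) k" "k ` ({0..1} \<times> {0..1}) \<subseteq> C"
    "\<And>s t. s \<in> {0..1} \<Longrightarrow> t \<in> {0..1} \<Longrightarrow> p (k (s, t)) = h (s, t)" "k (0, 0) = a"
proof -
  \<comment> \<open>Clamping both coordinates retracts the plane onto the unit square, which extends
    \<open>h\<close> with values still in \<open>S\<close>.\<close>
  define c where "c = (\<lambda>x::real. max 0 (min 1 x))"
  define h' where "h' = h \<circ> (\<lambda>(s, t). (c s, c t))"
  have c: "c x \<in> {0..1}" "x \<in> {0..1} \<Longrightarrow> c x = x" for x by (auto simp: c_def)
  have "continuous_on UNIV h'"
    unfolding h'_def case_prod_unfold
    by (intro continuous_on_compose continuous_on_subset[OF h(1)])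
       (use c in \<open>auto simp: c_def intro!: continuous_intros\<close>)
  moreover have "range h' \<subseteq> S" using h c unfolding h'_def by (auto simp: image_subset_iff)
  ultimately have "lifts_on C p h' ({0..1} \<times> {0..1})" by (rule lifts_on_square[OF cov])
  moreover have "(0, 0) \<in> {0..1::real} \<times> {0..1::real}" "p a = h' (0, 0)"
    using a by (auto simp: h'_def c)
  ultimately obtain k where "continuous_on ({0..1} \<times> {0..1}) k" "k ` ({0..1} \<times> {0..1}) \<subseteq> C"
    "\<forall>x\<in>{0..1} \<times> {0..1}. p (k x) = h' x" "k (0, 0) = a"
    using a unfolding lifts_on_def by meson
  then show ?thesis by (intro that[of k]) (auto simp: h'_def c)
qed

text \<open>A path is a square that does not depend on its second coordinate, so the lifted square
  restricts to a lift of the path.\<close>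

lemma covering_lift_path:
  assumes cov: "covering_space C p S" and a: "a \<in> C"
    and g: "path g" "path_image g \<subseteq> S" "pathstart g = p a"
  obtains k where "path k" "path_image k \<subseteq> C" "pathstart k = a" "\<And>t. t \<in> {0..1} \<Longrightarrow> p (k t) = g t"
proof -
  have "continuous_on ({0..1} \<times> {0..1::real}) (g \<circ> fst)"
    using g(1) unfolding path_def by (intro continuous_on_compose continuous_intros) auto
  moreover have "(g \<circ> fst) ` ({0..1} \<times> {0..1::real}) \<subseteq> S" using g(2) by (auto simp: path_image_def)
  moreover have "p a = (g \<circ> fst) (0, 0::real)" using g by (simp add: pathstart_def)
  ultimately obtain k where k: "continuous_on ({0..1} \<times> {0..1::real}) k" "k ` ({0..1} \<times> {0..1}) \<subseteq> C"
    "\<And>s t. s \<in> {0..1} \<Longrightarrow> t \<in> {0..1} \<Longrightarrow> p (k (s, t)) = (g \<circ> fst) (s, t)" "k (0, 0) = a"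
    using covering_lift_square[OF cov] a by metis
  show ?thesis
  proof (rule that[of "\<lambda>s. k (s, 0)"])
    show "path (\<lambda>s. k (s, 0))"
      unfolding path_def by (rule continuous_on_compose2[OF k(1)]) (auto intro!: continuous_intros)
  qed (use k in \<open>auto simp: path_image_def pathstart_def\<close>)
qed

lemma covering_lift_path_unique:
  assumes "covering_space C p S"
    and "path k" "path_image k \<subseteq> C" "path l" "path_image l \<subseteq> C"
    and "\<And>t. t \<in> {0..1} \<Longrightarrow> p (k t) = p (l t)" and "s \<in> {0..1}" "k s = l s" "t \<in> {0..1}"
  shows "k t = l t"
  by (rule covering_lift_unique[OF assms(1), of "{0..1}" s t k l])
     (use assms in \<open>auto simp: path_def path_image_def\<close>)

section \<open>Monodromy: lifts of homotopic paths and of null-homotopic loops\<close>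

lemma path_slice:
  assumes "continuous_on ({0..1} \<times> {0..1}) k" "k ` ({0..1} \<times> {0..1}) \<subseteq> C" "u \<in> {0..1}"
  shows "path (\<lambda>t. k (u, t))" "path_image (\<lambda>t. k (u, t)) \<subseteq> C"
    and "path (\<lambda>t. k (t, u))" "path_image (\<lambda>t. k (t, u)) \<subseteq> C"
proof -
  show "path (\<lambda>t. k (u, t))" "path (\<lambda>t. k (t, u))"
    unfolding path_def
    by (rule continuous_on_compose2[OF assms(1)]; use assms in \<open>auto intro!: continuous_intros\<close>)+
qed (use assms in \<open>auto simp: path_image_def\<close>)

text \<open>Lift the homotopy to \<open>K\<close>, starting at \<open>k 0\<close>. By uniqueness the
  edge over \<open>p \<circ> k\<close> is \<open>k\<close> and the two edges over the fixed end
  points are constant, so the opposite edge starts with \<open>l\<close> and equals it. Hence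
  \<open>l\<close> ends where \<open>k\<close> does.\<close>

lemma covering_monodromy:
  assumes cov: "covering_space C p S" and hom: "homotopic_paths S (p \<circ> k) (p \<circ> l)"
    and k: "path k" "path_image k \<subseteq> C" and l: "path l" "path_image l \<subseteq> C"
    and start: "pathstart k = pathstart l"
  shows "pathfinish k = pathfinish l"
proof -
  obtain h :: "real \<times> real \<Rightarrow> _" where h: "continuous_on ({0..1} \<times> {0..1}) h" "h \<in> ({0..1} \<times> {0..1}) \<rightarrow> S"
    "\<And>x. x \<in> {0..1} \<Longrightarrow> h (0, x) = p (k x)" "\<And>x. x \<in> {0..1} \<Longrightarrow> h (1, x) = p (l x)"
    "\<And>t. t \<in> {0..1} \<Longrightarrow> h (t, 0) = p (k 0)" "\<And>t. t \<in> {0..1} \<Longrightarrow> h (t, 1) = p (k 1)"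
    using hom unfolding homotopic_paths pathstart_def pathfinish_def o_def by blast
  have "k 0 \<in> C" "k 1 \<in> C" using k by (auto simp: path_image_def)
  have "h ` ({0..1} \<times> {0..1}) \<subseteq> S" using h by auto
  then obtain K where K: "continuous_on ({0..1} \<times> {0..1}) K" "K ` ({0..1} \<times> {0..1}) \<subseteq> C"
    "\<And>s t. s \<in> {0..1} \<Longrightarrow> t \<in> {0..1} \<Longrightarrow> p (K (s, t)) = h (s, t)" "K (0, 0) = k 0"
    using covering_lift_square[OF cov h(1), of "k 0"] h(3)[of 0] \<open>k 0 \<in> C\<close> by auto
  have 1: "K (0, t) = k t" if "t \<in> {0..1}" for t
    by (rule covering_lift_path_unique[OF cov, of "\<lambda>t. K (0, t)" k 0])
       (use path_slice[OF K(1,2)] k K h that in auto)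
  have 2: "K (t, 0) = k 0" if "t \<in> {0..1}" for t
    by (rule covering_lift_path_unique[OF cov, of "\<lambda>t. K (t, 0)" "\<lambda>_. k 0" 0])
       (use path_slice[OF K(1,2)] k K h that \<open>k 0 \<in> C\<close> in \<open>auto simp: path_def path_image_def\<close>)
  have 3: "K (1, t) = l t" if "t \<in> {0..1}" for t
    by (rule covering_lift_path_unique[OF cov, of "\<lambda>t. K (1, t)" l 0])
       (use path_slice[OF K(1,2)] l K h that 2[of 1] start in \<open>auto simp: pathstart_def\<close>)
  have 4: "K (t, 1) = k 1" if "t \<in> {0..1}" for t
    by (rule covering_lift_path_unique[OF cov, of "\<lambda>t. K (t, 1)" "\<lambda>_. k 1" 0])
       (use path_slice[OF K(1,2)] k K h that 1[of 1] \<open>k 1 \<in> C\<close> in \<open>auto simp: path_def path_image_def\<close>)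
  show ?thesis using 3[of 1] 4[of 1] by (simp add: pathfinish_def)
qed

text \<open>Here the homotopy is free and the base point moves. The lifted square is constant on the
  edge over \<open>c\<close>; the two adjacent sides lift the same path and meet there, so they
  coincide, in particular at the ends of \<open>k\<close>.\<close>

lemma covering_lift_null_loop_closed:
  assumes cov: "covering_space C p S" and hom: "homotopic_loops S l (\<lambda>_. c)"
    and k: "path k" "path_image k \<subseteq> C" and kl: "\<And>t. t \<in> {0..1} \<Longrightarrow> p (k t) = l t"
  shows "pathfinish k = pathstart k"
proof -
  obtain h :: "real \<times> real \<Rightarrow> _" where h: "continuous_on ({0..1} \<times> {0..1}) h" "h \<in> ({0..1} \<times> {0..1}) \<rightarrow> S"
    "\<And>x. x \<in> {0..1} \<Longrightarrow> h (0, x) = l x" "\<And>x. x \<in> {0..1} \<Longrightarrow> h (1, x) = c"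
    "\<And>t. t \<in> {0..1} \<Longrightarrow> h (t, 1) = h (t, 0)"
    using hom unfolding homotopic_loops pathstart_def pathfinish_def o_def by blast
  have "k 0 \<in> C" "k 1 \<in> C" using k by (auto simp: path_image_def)
  have "h ` ({0..1} \<times> {0..1}) \<subseteq> S" using h by auto
  then obtain K where K: "continuous_on ({0..1} \<times> {0..1}) K" "K ` ({0..1} \<times> {0..1}) \<subseteq> C"
    "\<And>s t. s \<in> {0..1} \<Longrightarrow> t \<in> {0..1} \<Longrightarrow> p (K (s, t)) = h (s, t)" "K (0, 0) = k 0"
    using covering_lift_square[OF cov h(1), of "k 0"] h(3)[of 0] kl[of 0] \<open>k 0 \<in> C\<close> by auto
  have 1: "K (0, t) = k t" if "t \<in> {0..1}" for t
    by (rule covering_lift_path_unique[OF cov, of "\<lambda>t. K (0, t)" k 0])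
       (use path_slice[OF K(1,2)] k K h kl that in auto)
  have 2: "K (1, t) = K (1, 0)" if "t \<in> {0..1}" for t
    by (rule covering_lift_path_unique[OF cov, of "\<lambda>t. K (1, t)" "\<lambda>_. K (1, 0)" 0])
       (use path_slice[OF K(1,2)] k K h kl that in \<open>auto simp: path_def path_image_def\<close>)
  have 3: "K (t, 0) = K (t, 1)" if "t \<in> {0..1}" for t
    by (rule covering_lift_path_unique[OF cov, of "\<lambda>t. K (t, 0)" "\<lambda>t. K (t, 1)" 1])
       (use path_slice[OF K(1,2)] k K h kl that 2[of 1] in auto)
  show ?thesis using 3[of 0] 1[of 1] K(4) by (simp add: pathfinish_def pathstart_def)
qed

section \<open>Length of curves\<close>

text \<open>The sums whose supremum is \<open>curve_length\<close>, named to allow induction on the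
  list of times.\<close>

definition poly_length :: "(real \<Rightarrow> 'a::metric_space) \<Rightarrow> real list \<Rightarrow> real"
  where "poly_length g ts = (\<Sum>i < length ts - 1. dist (g (ts ! i)) (g (ts ! (i + 1))))"

lemma poly_length_simps [simp]:
  "poly_length g [] = 0" "poly_length g [x] = 0"
  "poly_length g (x # y # ts) = dist (g x) (g y) + poly_length g (y # ts)"
  by (simp_all add: poly_length_def sum.lessThan_Suc_shift del: sum.lessThan_Suc)

lemma poly_length_map: "poly_length g (map \<phi> ts) = poly_length (g \<circ> \<phi>) ts"
  by (simp add: poly_length_def)

lemma poly_length_cong: "(\<And>t. t \<in> set ts \<Longrightarrow> g t = h t) \<Longrightarrow> poly_length g ts = poly_length h ts"
  by (auto simp: poly_length_def intro!: sum.cong)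

lemma poly_length_append_Cons:
  "poly_length g (xs @ c # ys) = poly_length g (xs @ [c]) + poly_length g (c # ys)"
proof (induction xs)
  case (Cons x xs)
  then show ?case by (cases xs) auto
qed simp

lemma poly_length_append_ge: "poly_length g xs + poly_length g ys \<le> poly_length g (xs @ ys)"
proof (induction xs)
  case (Cons x xs)
  then show ?case by (cases xs; cases ys) (auto simp: add.assoc)
qed simp

lemma poly_length_insert: "poly_length g (xs @ ys) \<le> poly_length g (xs @ c # ys)"
proof (induction xs)
  case Nil
  then show ?case by (cases ys) auto
next
  case (Cons x xs)
  then show ?case
  proof (cases xs)
    case Nil
    then show ?thesis using dist_triangle[of "g x" _ "g c"] by (cases ys) (auto simp: add.commute)
  qed auto
qed

lemma poly_length_rev: "poly_length g (rev ts) = poly_length g ts"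
proof (induction ts)
  case (Cons x ts)
  then show ?case
  proof (cases ts)
    case (Cons y zs)
    have "poly_length g (rev (x # ts)) = poly_length g (rev zs @ y # [x])"
      using Cons by simp
    also have "\<dots> = poly_length g (rev ts) + dist (g y) (g x)"
      by (subst poly_length_append_Cons) (simp add: Cons)
    finally show ?thesis using Cons Cons.IH by (simp add: dist_commute)
  qed simp
qed simp

lemma curve_length_poly:
  "curve_length g = (SUP ts \<in> {ts. sorted ts \<and> set ts \<subseteq> {0..1}}. ereal (poly_length g ts))"
  by (simp add: curve_length_def poly_length_def)

lemma poly_length_le_curve_length:
  "sorted ts \<Longrightarrow> set ts \<subseteq> {0..1} \<Longrightarrow> ereal (poly_length g ts) \<le> curve_length g"
  unfolding curve_length_poly by (rule SUP_upper) auto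

lemma curve_length_leI:
  "(\<And>ts. sorted ts \<Longrightarrow> set ts \<subseteq> {0..1} \<Longrightarrow> ereal (poly_length g ts) \<le> l) \<Longrightarrow> curve_length g \<le> l"
  unfolding curve_length_poly by (rule SUP_least) auto

lemma curve_length_nonneg: "curve_length g \<ge> 0"
  using poly_length_le_curve_length[of "[]" g] by (simp add: zero_ereal_def)

lemma curve_length_cong: "(\<And>t. t \<in> {0..1} \<Longrightarrow> g t = h t) \<Longrightarrow> curve_length g = curve_length h"
  unfolding curve_length_poly by (intro SUP_cong refl) (metis (mono_tags) mem_Collect_eq poly_length_cong subsetD)

lemma dist_le_curve_length:
  assumes "s \<in> {0..1}" "t \<in> {0..1}"
  shows "ereal (dist (g s) (g t)) \<le> curve_length g"
proof (cases "s \<le> t")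
  case True
  then show ?thesis using poly_length_le_curve_length[of "[s, t]" g] assms by simp
next
  case False
  then show ?thesis using poly_length_le_curve_length[of "[t, s]" g] assms by (simp add: dist_commute)
qed

lemma curve_length_const: "curve_length (\<lambda>_. c) = 0"
  by (rule antisym[OF _ curve_length_nonneg], rule curve_length_leI) (simp add: poly_length_def)

lemma curve_length_reversepath: "curve_length (reversepath g) = curve_length g"
proof -
  have "curve_length (reversepath g) \<le> curve_length g" for g :: "real \<Rightarrow> 'a"
  proof (rule curve_length_leI)
    fix ts :: "real list" assume ts: "sorted ts" "set ts \<subseteq> {0..1}"
    have "poly_length (reversepath g) ts = poly_length g (rev (map (\<lambda>t. 1 - t) ts))"
      by (simp add: poly_length_rev poly_length_map reversepath_def o_def)
    also have "ereal \<dots> \<le> curve_length g"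
      using ts by (intro poly_length_le_curve_length)
        (auto simp: sorted_wrt_rev sorted_wrt_map intro: sorted_wrt_mono_rel[OF _ ts(1)])
    finally show "ereal (poly_length (reversepath g) ts) \<le> curve_length g" by simp
  qed
  from this[of g] this[of "reversepath g"] show ?thesis by (simp add: antisym)
qed

text \<open>Adding the time 1/2 to a subdivision can only raise its sum, by the triangle inequality;
  the two parts then rescale to subdivisions for \<open>g\<close> and \<open>h\<close>.\<close>

lemma curve_length_join_le:
  assumes "pathfinish g = pathstart h"
  shows "curve_length (g +++ h) \<le> curve_length g + curve_length h"
proof (rule curve_length_leI)
  fix ts :: "real list" assume ts: "sorted ts" "set ts \<subseteq> {0..1}"
  define xs where "xs = takeWhile (\<lambda>t. t \<le> 1/2) ts"
  define ys where "ys = dropWhile (\<lambda>t. t \<le> 1/2) ts"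
  have xy: "ts = xs @ ys" by (simp add: xs_def ys_def)
  have srt: "sorted xs" "sorted ys" using ts(1) unfolding xy sorted_append by auto
  have xs: "t \<le> 1/2" if "t \<in> set xs" for t using that unfolding xs_def by (auto dest: set_takeWhileD)
  have ys: "1/2 < t" if "t \<in> set ys" for t
  proof -
    have "ys \<noteq> []" using that by auto
    then have "\<not> hd ys \<le> 1/2" unfolding ys_def by (rule hd_dropWhile)
    moreover have "hd ys \<le> t" using srt(2) that \<open>ys \<noteq> []\<close> by (cases ys) auto
    ultimately show ?thesis by auto
  qed
  have 1: "poly_length (g +++ h) (xs @ [1/2]) = poly_length g (map (\<lambda>t. 2 * t) (xs @ [1/2]))"
    unfolding poly_length_map by (rule poly_length_cong) (auto simp: joinpaths_def dest: xs)
  \<comment> \<open>At time 1/2 the joined path takes the value of \<open>g\<close>, so here the end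
    of \<open>g\<close> must be the start of \<open>h\<close>.\<close>
  have 2: "poly_length (g +++ h) (1/2 # ys) = poly_length h (map (\<lambda>t. 2 * t - 1) (1/2 # ys))"
    unfolding poly_length_map
  proof (rule poly_length_cong)
    fix t assume t: "t \<in> set (1/2 # ys)"
    show "(g +++ h) t = (h \<circ> (\<lambda>t. 2 * t - 1)) t"
    proof (cases "t = 1/2")
      case True
      show ?thesis unfolding True using assms by (simp add: joinpaths_def pathstart_def pathfinish_def)
    next
      case False
      then show ?thesis using t ys[of t] by (auto simp: joinpaths_def)
    qed
  qed
  have "sorted (xs @ [1/2])" "sorted (1/2 # ys)"
    using srt xs ys by (auto simp: sorted_append less_imp_le)
  then have srt': "sorted (map (\<lambda>t. 2 * t) (xs @ [1/2]))" "sorted (map (\<lambda>t. 2 * t - 1) (1/2 # ys))"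
    by (intro sorted_map_mono; simp add: mono_onI)+
  have "0 \<le> 2 * t \<and> 2 * t \<le> 1" if "t \<in> set xs" for t
    using xs[OF that] ts(2) that unfolding xy by auto
  then have "ereal (poly_length g (map (\<lambda>t. 2 * t) (xs @ [1/2]))) \<le> curve_length g"
    by (intro poly_length_le_curve_length srt') auto
  moreover have "0 \<le> 2 * t - 1 \<and> 2 * t - 1 \<le> 1" if "t \<in> set ys" for t
    using ys[OF that] ts(2) that unfolding xy by auto
  then have "ereal (poly_length h (map (\<lambda>t. 2 * t - 1) (1/2 # ys))) \<le> curve_length h"
    by (intro poly_length_le_curve_length srt') auto
  moreover have "poly_length (g +++ h) ts \<le>
      poly_length g (map (\<lambda>t. 2 * t) (xs @ [1/2])) + poly_length h (map (\<lambda>t. 2 * t - 1) (1/2 # ys))"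
    using poly_length_insert[of "g +++ h" xs ys "1/2"] poly_length_append_Cons[of "g +++ h" xs "1/2" ys]
    unfolding xy 1 2 by linarith
  ultimately show "ereal (poly_length (g +++ h) ts) \<le> curve_length g + curve_length h"
    by (metis add_mono ereal_less_eq(3) order_trans plus_ereal.simps(1))
qed

text \<open>Rescaled subdivisions of the parts before and after \<open>u\<close> concatenate to a
  subdivision of the whole, and the jump between them only adds length.\<close>

lemma curve_length_split:
  assumes u: "u \<in> {0..1}"
  shows "curve_length (\<lambda>t. g (u * t)) + curve_length (\<lambda>t. g (u + (1 - u) * t)) \<le> curve_length g"
proof -
  have *: "ereal (poly_length (\<lambda>t. g (u * t)) xs) + ereal (poly_length (\<lambda>t. g (u + (1 - u) * t)) ys) \<le> curve_length g"
    if xs: "sorted xs" "set xs \<subseteq> {0..1}" and ys: "sorted ys" "set ys \<subseteq> {0..1}" for xs ys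
  proof -
    let ?xs = "map (\<lambda>t. u * t) xs" and ?ys = "map (\<lambda>t. u + (1 - u) * t) ys"
    have a: "u * t \<in> {0..u}" if "t \<in> set xs" for t
      using that u xs by (auto simp: mult_left_le)
    have b: "u + (1 - u) * t \<in> {u..1}" if "t \<in> set ys" for t
    proof -
      have "0 \<le> t" "t \<le> 1" using that ys by auto
      then have "0 \<le> (1 - u) * t" "(1 - u) * t \<le> 1 - u" using u by (auto simp: mult_left_le)
      then show ?thesis by simp
    qed
    have "poly_length (\<lambda>t. g (u * t)) xs = poly_length g ?xs" "poly_length (\<lambda>t. g (u + (1 - u) * t)) ys = poly_length g ?ys"
      by (auto simp: poly_length_map o_def)
    then have "poly_length (\<lambda>t. g (u * t)) xs + poly_length (\<lambda>t. g (u + (1 - u) * t)) ys \<le> poly_length g (?xs @ ?ys)"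
      using poly_length_append_ge by metis
    moreover have "sorted ?xs" "sorted ?ys"
      using u xs(1) ys(1) by (auto intro!: sorted_map_mono mono_onI mult_left_mono)
    then have "ereal (poly_length g (?xs @ ?ys)) \<le> curve_length g"
      using a b u by (intro poly_length_le_curve_length) (fastforce simp: sorted_append)+
    ultimately show ?thesis by (metis ereal_less_eq(3) order_trans plus_ereal.simps(1))
  qed
  define P where "P = {ts :: real list. sorted ts \<and> set ts \<subseteq> {0..1}}"
  have ne: "P \<noteq> {}" unfolding P_def by (auto intro: exI[of _ "[]"])
  have fin: "curve_length h \<noteq> - \<infinity>" for h :: "real \<Rightarrow> 'a"
    using curve_length_nonneg[of h] by auto
  \<comment> \<open>A sum of two suprema becomes a double supremum; the index set is nonempty and no
    length is minus infinity.\<close>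
  have "curve_length (\<lambda>t. g (u * t)) + curve_length (\<lambda>t. g (u + (1 - u) * t))
      = (SUP xs\<in>P. SUP ys\<in>P. ereal (poly_length (\<lambda>t. g (u * t)) xs) + ereal (poly_length (\<lambda>t. g (u + (1 - u) * t)) ys))"
    using ne fin
    by (simp del: plus_ereal.simps add: SUP_ereal_add_right SUP_ereal_add_left flip: curve_length_poly[folded P_def])
  also have "\<dots> \<le> curve_length g"
    using * by (intro SUP_least) (simp add: P_def)
  finally show ?thesis .
qed

section \<open>Elementary counting\<close>

text \<open>As long as \<open>B m\<close>, the points of \<open>K\<close> within
  \<open>c * m\<close> of \<open>z0\<close>, is not all of \<open>K\<close>, some step of
  \<open>R\<close> leaves it and lands in \<open>B (Suc m)\<close>. Each increase of
  \<open>m\<close> thus gains a point, and \<open>card K - 1\<close> increases exhaust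
  \<open>K\<close>.\<close>

lemma chain_card_bound:
  fixes dst :: "'a \<Rightarrow> 'a \<Rightarrow> real"
  assumes K: "finite K" "z0 \<in> K" and reach: "\<And>z. z \<in> K \<Longrightarrow> (z0, z) \<in> R\<^sup>*" and R: "R \<subseteq> K \<times> K"
    and refl: "dst z0 z0 = 0" and tri: "\<And>y y'. (y, y') \<in> R \<Longrightarrow> dst z0 y' \<le> dst z0 y + c" and c: "c \<ge> 0"
    and z: "z \<in> K"
  shows "dst z0 z \<le> c * (real (card K) - 1)"
proof -
  define B where "B m = {y \<in> K. dst z0 y \<le> c * real m}" for m
  have BK: "B m \<subseteq> K" for m by (auto simp: B_def)
  have z0B: "z0 \<in> B m" for m using K refl c by (simp add: B_def)
  have mono: "B m \<subseteq> B (Suc m)" for m using c by (auto simp: B_def algebra_simps)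
  have grow: "m + 1 \<le> card (B m) \<or> B m = K" for m
  proof (induction m)
    case 0
    have "finite (B 0)" using BK K(1) finite_subset by blast
    then have "card (B 0) > 0" using z0B[of 0] by (auto simp: card_gt_0_iff)
    then show ?case by simp
  next
    case (Suc m)
    show ?case
    proof (cases "B m = K")
      case True
      then show ?thesis using mono BK by blast
    next
      case False
      have "\<exists>y y'. y \<in> B m \<and> y' \<notin> B m \<and> (y, y') \<in> R"
      proof (rule ccontr)
        assume cl: "\<nexists>y y'. y \<in> B m \<and> y' \<notin> B m \<and> (y, y') \<in> R"
        have "w \<in> B m" if "(z0, w) \<in> R\<^sup>*" for w
          using that by induction (use cl z0B in auto)
        then show False using reach False BK by blast
      qed
      then obtain y y' where y: "y \<in> B m" "y' \<notin> B m" "(y, y') \<in> R" by blast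
      then have "y' \<in> B (Suc m)"
        using R tri[OF y(3)] by (auto simp: B_def algebra_simps)
      then have "B m \<subset> B (Suc m)" using y mono by blast
      then have "card (B m) < card (B (Suc m))" using K(1) BK by (meson finite_subset psubset_card_mono)
      then show ?thesis using Suc False by auto
    qed
  qed
  have "card K \<ge> 1" using K by (auto simp: Suc_le_eq card_gt_0_iff)
  moreover have "B (card K - 1) = K"
    using grow[of "card K - 1"] card_seteq[OF K(1) BK] \<open>card K \<ge> 1\<close> by auto
  ultimately show ?thesis using z by (auto simp: B_def of_nat_diff)
qed

text \<open>The summands read 1, 2, ..., 2, 1. Dropping both ends and lowering the others by 1 gives
  the sequence for \<open>M - 2\<close>, hence the induction in steps of two. The sum is the floor
  of (M + 1)^2 / 4.\<close>

lemma sum_min_triangular: "M * (M + 2) \<le> 4 * (\<Sum>j<M. min (j + 1) (M - j))" for M :: nat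
proof (induction M rule: induct_nat_012)
  case (ge2 n)
  have "(\<Sum>j<Suc (Suc n). f j) = f 0 + (\<Sum>j<n. f (Suc j)) + f (Suc n)" for f :: "nat \<Rightarrow> nat"
    by (subst sum.lessThan_Suc, subst sum.lessThan_Suc_shift) simp
  then have "(\<Sum>j<Suc (Suc n). min (j + 1) (Suc (Suc n) - j))
      = 1 + (\<Sum>j<n. min (Suc j + 1) (Suc (Suc n) - Suc j)) + 1"
    by (simp only:)
  also have "(\<Sum>j<n. min (Suc j + 1) (Suc (Suc n) - Suc j)) = (\<Sum>j<n. min (j + 1) (n - j) + 1)"
    by (rule sum.cong) auto
  also have "\<dots> = (\<Sum>j<n. min (j + 1) (n - j)) + n" by (subst sum.distrib) simp
  finally have "(\<Sum>j<Suc (Suc n). min (j + 1) (Suc (Suc n) - j)) = (\<Sum>j<n. min (j + 1) (n - j)) + n + 2" by simp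
  then show ?case using ge2(1) by (simp add: algebra_simps)
qed auto

section \<open>The lifted metric\<close>

lemma curves_between_join:
  assumes "g \<in> curves_between S p q" "h \<in> curves_between S q r"
  shows "g +++ h \<in> curves_between S p r"
  using assms subset_path_image_join[of g S h] by (auto simp: curves_between_def)

lemma curves_between_reversepath:
  "g \<in> curves_between S p q \<Longrightarrow> reversepath g \<in> curves_between S q p"
  by (auto simp: curves_between_def)

lemma curves_between_endpoints: "g \<in> curves_between S p q \<Longrightarrow> p \<in> S \<and> q \<in> S"
  by (auto simp: curves_between_def)

lemma curves_between_reparametrize:
  assumes "g \<in> curves_between S p q" "continuous_on {0..1} \<phi>" "\<phi> ` {0..1} \<subseteq> {0..1}"
  shows "(\<lambda>t. g (\<phi> t)) \<in> curves_between S (g (\<phi> 0)) (g (\<phi> 1))"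
proof -
  have "continuous_on {0..1} (\<lambda>t. g (\<phi> t))"
    by (rule continuous_on_compose2[of "{0..1}" g]) (use assms in \<open>auto simp: curves_between_def path_def\<close>)
  then show ?thesis
    using assms by (auto simp: curves_between_def path_def path_image_def pathstart_def pathfinish_def)
qed

lemma curves_between_compose:
  assumes "g \<in> curves_between S p q" "continuous_on S f" "f ` S \<subseteq> T"
  shows "f \<circ> g \<in> curves_between T (f p) (f q)"
  using assms
  by (auto simp: curves_between_def path_image_compose pathstart_compose pathfinish_compose
      intro!: path_continuous_image intro: continuous_on_subset)

lemma curves_between_const: "p \<in> S \<Longrightarrow> (\<lambda>_. p) \<in> curves_between S p p"
  by (auto simp: curves_between_def path_def path_image_def pathstart_def pathfinish_def)

locale length_cover =
  fixes X :: "'a::metric_space set" and Xt :: "'b::topological_space set" and \<rho> :: "'b \<Rightarrow> 'a"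
  assumes cover: "covering_space Xt \<rho> X" and conn: "path_connected Xt"
    and simply: "simply_connected Xt" and length: "length_space X"
begin

lemma cont: "continuous_on Xt \<rho>" and onto: "\<rho> ` Xt = X"
  using cover by (simp_all add: covering_space_imp_continuous covering_space_imp_surjective)

lemma exists_curve:
  assumes "p \<in> Xt" "q \<in> Xt"
  obtains g where "g \<in> curves_between Xt p q"
  using conn assms unfolding path_connected_def curves_between_def by blast

lemma short_curve:
  assumes "x \<in> X" "y \<in> X" "dist x y < r"
  obtains c where "c \<in> curves_between X x y" "curve_length c < ereal r"
proof -
  have "(INF g \<in> curves_between X x y. curve_length g) < ereal r"
    using length assms unfolding length_space_def by (metis less_ereal.simps(1))
  then show ?thesis using that unfolding INF_less_iff by blast
qed

text \<open>Faithful on \<open>Xt\<close>, where the lifted distance is finite by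
  \<open>lifted_dist_finite\<close>; an infinite value would become 0.\<close>

definition d :: "'b \<Rightarrow> 'b \<Rightarrow> real" where "d p q = real_of_ereal (lifted_dist Xt \<rho> p q)"

lemma lifted_dist_less_iff:
  "lifted_dist Xt \<rho> p q < r \<longleftrightarrow> (\<exists>g\<in>curves_between Xt p q. curve_length (\<rho> \<circ> g) < r)"
  unfolding lifted_dist_def by (rule INF_less_iff)

lemma curve_length_lift_join:
  assumes "g \<in> curves_between Xt p q" "h \<in> curves_between Xt q r"
  shows "curve_length (\<rho> \<circ> (g +++ h)) \<le> curve_length (\<rho> \<circ> g) + curve_length (\<rho> \<circ> h)"
  using assms unfolding path_compose_join
  by (intro curve_length_join_le) (auto simp: curves_between_def pathstart_compose pathfinish_compose)

text \<open>This ties the given topology of \<open>Xt\<close> to lengths. A curve in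
  \<open>X\<close> of length below \<open>s\<close> starting at \<open>\<rho> y\<close> stays in a
  ball, hence in the image \<open>u\<close> of a neighbourhood \<open>T\<close> on which
  \<open>\<rho>\<close> is a homeomorphism, and the inverse \<open>q\<close> lifts it with the same
  length.\<close>

lemma locally_small:
  assumes y: "y \<in> Xt" and e: "e > 0"
  obtains V where "openin (top_of_set Xt) V" "y \<in> V" "\<And>y'. y' \<in> V \<Longrightarrow> lifted_dist Xt \<rho> y y' < ereal e"
proof -
  obtain T u q where T: "y \<in> T" "openin (top_of_set Xt) T" and u: "\<rho> y \<in> u" "openin (top_of_set X) u"
    and q: "homeomorphism T u \<rho> q"
    using covering_space_local_homeomorphism[OF cover y] by metis
  obtain r where r: "r > 0" "ball (\<rho> y) r \<inter> X \<subseteq> u"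
    using u by (meson openin_contains_ball)
  \<comment> \<open>The bound by \<open>r\<close> keeps short curves inside \<open>u\<close>; the
    bound by \<open>e\<close> is the length asked for.\<close>
  define s where "s = min r e"
  define V where "V = T \<inter> (Xt \<inter> \<rho> -` ball (\<rho> y) s)"
  have Tu: "T \<subseteq> Xt" "u \<subseteq> X" using T u openin_imp_subset by blast+
  show ?thesis
  proof
    show "openin (top_of_set Xt) V"
      unfolding V_def using T cont by (intro openin_Int continuous_openin_preimage_gen) auto
    show "y \<in> V" using T y r e by (simp add: V_def s_def)
    fix y' assume y': "y' \<in> V"
    then have "\<rho> y' \<in> X" "dist (\<rho> y) (\<rho> y') < s" "y' \<in> T" using onto by (auto simp: V_def)
    then obtain c where c: "c \<in> curves_between X (\<rho> y) (\<rho> y')" "curve_length c < ereal s"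
      using short_curve[of "\<rho> y" "\<rho> y'" s] onto y by auto
    have cu: "c ` {0..1} \<subseteq> u"
    proof
      fix x assume "x \<in> c ` {0..1}"
      then obtain t where t: "t \<in> {0..1}" "x = c t" by auto
      then have "ereal (dist (c 0) (c t)) < ereal s"
        using order_le_less_trans[OF dist_le_curve_length[of 0 t c] c(2)] by simp
      then have "x \<in> ball (\<rho> y) r" using t c(1) by (auto simp: curves_between_def pathstart_def s_def)
      moreover have "x \<in> X" using t c(1) by (auto simp: curves_between_def path_image_def)
      ultimately show "x \<in> u" using r by auto
    qed
    have "q \<circ> c \<in> curves_between T (q (\<rho> y)) (q (\<rho> y'))"
    proof (rule curves_between_compose)
      show "c \<in> curves_between u (\<rho> y) (\<rho> y')"
        using c(1) cu by (auto simp: curves_between_def path_image_def)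
    qed (use q in \<open>auto simp: homeomorphism_def\<close>)
    moreover have "q (\<rho> y) = y" "q (\<rho> y') = y'" using q T \<open>y' \<in> T\<close> by (auto simp: homeomorphism_def)
    ultimately have "q \<circ> c \<in> curves_between Xt y y'" using Tu by (auto simp: curves_between_def)
    moreover have "curve_length (\<rho> \<circ> (q \<circ> c)) = curve_length c"
      using q cu by (intro curve_length_cong) (auto simp: homeomorphism_def image_subset_iff)
    moreover have "ereal s \<le> ereal e" by (simp add: s_def)
    ultimately show "lifted_dist Xt \<rho> y y' < ereal e"
      unfolding lifted_dist_less_iff using c(2) by (metis order_less_le_trans)
  qed
qed

section \<open>Finiteness and metric properties of the lifted distance\<close>

lemma lifted_dist_nonneg: "lifted_dist Xt \<rho> p q \<ge> 0"
  unfolding lifted_dist_def by (rule INF_greatest) (rule curve_length_nonneg)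

lemma lifted_dist_sym: "lifted_dist Xt \<rho> p q = lifted_dist Xt \<rho> q p"
proof -
  have "lifted_dist Xt \<rho> q p \<le> lifted_dist Xt \<rho> p q" for p q
    unfolding lifted_dist_def
  proof (rule INF_greatest)
    fix g assume "g \<in> curves_between Xt p q"
    then have "reversepath g \<in> curves_between Xt q p" by (rule curves_between_reversepath)
    moreover have "curve_length (\<rho> \<circ> reversepath g) = curve_length (\<rho> \<circ> g)"
      using curve_length_reversepath[of "\<rho> \<circ> g"] by (simp add: reversepath_def o_def)
    ultimately show "(INF g \<in> curves_between Xt q p. curve_length (\<rho> \<circ> g)) \<le> curve_length (\<rho> \<circ> g)"
      by (metis INF_lower)
  qed
  then show ?thesis by (intro antisym)
qed

lemma lifted_dist_join_less:
  assumes "lifted_dist Xt \<rho> p q < a" "lifted_dist Xt \<rho> q r < b"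
  shows "lifted_dist Xt \<rho> p r < a + b"
proof -
  obtain g h where g: "g \<in> curves_between Xt p q" "curve_length (\<rho> \<circ> g) < a"
    and h: "h \<in> curves_between Xt q r" "curve_length (\<rho> \<circ> h) < b"
    using assms unfolding lifted_dist_less_iff by blast
  have "curve_length (\<rho> \<circ> g) + curve_length (\<rho> \<circ> h) < a + b"
    using g h by (intro ereal_add_strict_mono2) auto
  then show ?thesis
    unfolding lifted_dist_less_iff
    using curve_length_lift_join[OF g(1) h(1)] curves_between_join[OF g(1) h(1)]
    by (meson order_le_less_trans)
qed

text \<open>The points at finite distance from \<open>p\<close> form an open and closed set, since
  each point has a neighbourhood of points at distance below 1; and \<open>Xt\<close> is
  connected.\<close>

lemma lifted_dist_finite:
  assumes "p \<in> Xt" "q \<in> Xt"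
  shows "lifted_dist Xt \<rho> p q < \<infinity>"
proof -
  define E where "E = {y \<in> Xt. lifted_dist Xt \<rho> p y < \<infinity>}"
  have tr: "lifted_dist Xt \<rho> p z < \<infinity>" if "lifted_dist Xt \<rho> p y < \<infinity>" "lifted_dist Xt \<rho> y z < 1" for y z
    using lifted_dist_join_less[OF that(1)] lifted_dist_join_less[OF that] by simp
  have loc: "\<exists>V. openin (top_of_set Xt) V \<and> y \<in> V \<and> (\<forall>z\<in>V. lifted_dist Xt \<rho> y z < 1)" if "y \<in> Xt" for y
    using locally_small[OF that, of 1] by (metis one_ereal_def zero_less_one)
  have 1: "openin (top_of_set Xt) E"
  proof (subst openin_subopen, intro ballI)
    fix y assume y: "y \<in> E"
    then obtain V where "openin (top_of_set Xt) V" "y \<in> V" "\<forall>z\<in>V. lifted_dist Xt \<rho> y z < 1"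
      using loc unfolding E_def by blast
    then show "\<exists>V. openin (top_of_set Xt) V \<and> y \<in> V \<and> V \<subseteq> E"
      using y tr openin_imp_subset unfolding E_def by (intro exI[of _ V]) blast
  qed
  have 2: "openin (top_of_set Xt) (Xt - E)"
  proof (subst openin_subopen, intro ballI)
    fix y assume y: "y \<in> Xt - E"
    then obtain V where "openin (top_of_set Xt) V" "y \<in> V" "\<forall>z\<in>V. lifted_dist Xt \<rho> y z < 1"
      using loc by blast
    then show "\<exists>V. openin (top_of_set Xt) V \<and> y \<in> V \<and> V \<subseteq> Xt - E"
      using y tr[of _ y] openin_imp_subset[of _ Xt V] unfolding E_def
      by (intro exI[of _ V]) (auto simp: lifted_dist_sym[of _ y])
  qed
  have "connected Xt" using conn by (rule path_connected_imp_connected)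
  then have "E = {} \<or> E = Xt"
    using 1 2 by (simp add: connected_clopen closedin_def openin_imp_subset)
  moreover have "p \<in> E"
    using assms locally_small[OF assms(1), of 1] unfolding E_def
    by (metis (mono_tags, lifting) ereal_infty_less(1) less_ereal.simps(2) mem_Collect_eq order_less_trans zero_less_one)
  ultimately show ?thesis using assms unfolding E_def by blast
qed

lemma ereal_d: "p \<in> Xt \<Longrightarrow> q \<in> Xt \<Longrightarrow> ereal (d p q) = lifted_dist Xt \<rho> p q"
  using lifted_dist_finite[of p q] lifted_dist_nonneg[of p q] unfolding d_def
  by (intro ereal_real') auto

lemma d_nonneg: "d p q \<ge> 0"
  unfolding d_def by (simp add: lifted_dist_nonneg real_of_ereal_pos)

lemma d_sym: "d p q = d q p"
  unfolding d_def by (metis lifted_dist_sym)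

lemma d_less_iff:
  assumes "p \<in> Xt" "q \<in> Xt"
  shows "d p q < r \<longleftrightarrow> (\<exists>g\<in>curves_between Xt p q. curve_length (\<rho> \<circ> g) < ereal r)"
  using ereal_d[OF assms] lifted_dist_less_iff[of p q "ereal r"] by (metis less_ereal.simps(1))

lemma d_refl:
  assumes "p \<in> Xt"
  shows "d p p = 0"
proof -
  have "curve_length (\<rho> \<circ> (\<lambda>_. p)) = 0" by (simp add: o_def curve_length_const)
  then have "d p p < r" if "r > 0" for r
    using that assms curves_between_const[OF assms] unfolding d_less_iff[OF assms assms]
    by (intro bexI[of _ "\<lambda>_. p"]) (simp_all add: zero_ereal_def)
  then have "d p p \<le> 0" by (meson dense_ge order_less_imp_le)
  then show ?thesis using d_nonneg[of p p] by linarith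
qed

lemma d_triangle:
  assumes "p \<in> Xt" "q \<in> Xt" "r \<in> Xt"
  shows "d p r \<le> d p q + d q r"
proof (rule field_le_epsilon)
  fix e :: real assume "e > 0"
  then have "lifted_dist Xt \<rho> p q < ereal (d p q + e/2)" "lifted_dist Xt \<rho> q r < ereal (d q r + e/2)"
    using assms by (simp_all flip: ereal_d)
  from lifted_dist_join_less[OF this] show "d p r \<le> d p q + d q r + e"
    using assms by (simp flip: ereal_d)
qed

text \<open>Cut a curve of length below \<open>r\<close> at \<open>y\<close>: the two parts bound
  \<open>d p y\<close> and \<open>d y q\<close>, and by \<open>curve_length_split\<close> their
  lengths add up to at most the whole. Such almost shortest curves play the part of
  geodesics.\<close>

lemma d_curve:
  assumes "p \<in> Xt" "q \<in> Xt" "d p q < r"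
  obtains g where "g \<in> curves_between Xt p q" "\<And>y. y \<in> path_image g \<Longrightarrow> d p y + d y q < r"
proof -
  obtain g where g: "g \<in> curves_between Xt p q" "curve_length (\<rho> \<circ> g) < ereal r"
    using assms d_less_iff by blast
  show ?thesis
  proof (rule that[OF g(1)])
    fix y assume "y \<in> path_image g"
    then obtain u where u: "u \<in> {0..1}" "y = g u" by (auto simp: path_image_def)
    then have y: "y \<in> Xt" using g(1) by (auto simp: curves_between_def path_image_def)
    have "g 0 = p" "g 1 = q" using g(1) by (auto simp: curves_between_def pathstart_def pathfinish_def)
    have "0 \<le> u + (1 - u) * t \<and> u + (1 - u) * t \<le> 1" if "0 \<le> t" "t \<le> 1" for t
      using u that mult_left_le[of t "1 - u"] by auto
    moreover have "continuous_on {0..1} (\<lambda>t. u + (1 - u) * t)" by (intro continuous_intros)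
    ultimately have s: "(\<lambda>t. g (u * t)) \<in> curves_between Xt p y" "(\<lambda>t. g (u + (1 - u) * t)) \<in> curves_between Xt y q"
      using curves_between_reparametrize[OF g(1), of "\<lambda>t. u * t"] u \<open>g 0 = p\<close> \<open>g 1 = q\<close>
        curves_between_reparametrize[OF g(1), of "\<lambda>t. u + (1 - u) * t"]
      by (auto simp: image_subset_iff mult_le_one intro!: continuous_intros)
    have "ereal (d p y) \<le> curve_length (\<lambda>t. (\<rho> \<circ> g) (u * t))" "ereal (d y q) \<le> curve_length (\<lambda>t. (\<rho> \<circ> g) (u + (1 - u) * t))"
      using INF_lower[OF s(1), of "\<lambda>g. curve_length (\<rho> \<circ> g)"] INF_lower[OF s(2), of "\<lambda>g. curve_length (\<rho> \<circ> g)"] assms y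
      by (simp_all add: ereal_d lifted_dist_def o_def)
    then have "ereal (d p y) + ereal (d y q) \<le> curve_length (\<lambda>t. (\<rho> \<circ> g) (u * t)) + curve_length (\<lambda>t. (\<rho> \<circ> g) (u + (1 - u) * t))"
      by (rule add_mono)
    also have "\<dots> < ereal r" using curve_length_split[OF u(1)] g(2) by (rule order_le_less_trans)
    finally show "d p y + d y q < r" by simp
  qed
qed

lemma d_nbhd:
  assumes "y \<in> Xt" "e > 0"
  obtains V where "openin (top_of_set Xt) V" "y \<in> V" "\<And>y'. y' \<in> V \<Longrightarrow> d y y' < e"
proof -
  obtain V where V: "openin (top_of_set Xt) V" "y \<in> V" "\<And>y'. y' \<in> V \<Longrightarrow> lifted_dist Xt \<rho> y y' < ereal e"
    using locally_small[OF assms] by metis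
  then have "V \<subseteq> Xt" using openin_imp_subset by blast
  then show ?thesis
    using V assms by (intro that[of V]) (auto simp: subset_iff simp flip: ereal_d)
qed

lemma continuous_d:
  assumes p: "p \<in> Xt"
  shows "continuous_on Xt (d p)"
  unfolding continuous_on_def
proof (intro ballI tendstoI)
  fix y and e :: real assume y: "y \<in> Xt" and e: "e > 0"
  obtain V where V: "openin (top_of_set Xt) V" "y \<in> V" "\<And>y'. y' \<in> V \<Longrightarrow> d y y' < e"
    using d_nbhd[OF y e] by metis
  then obtain O' where O': "open O'" "V = Xt \<inter> O'" by (auto simp: openin_open)
  have "dist (d p x) (d p y) < e" if "x \<in> O'" "x \<in> Xt" for x
    using V(3)[of x] that O' d_triangle[OF p that(2) y] d_triangle[OF p y that(2)] d_sym[of x y]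
    by (simp add: dist_real_def abs_less_iff)
  then show "\<forall>\<^sub>F x in at y within Xt. dist (d p x) (d p y) < e"
    unfolding eventually_at_topological using O' V by (intro exI[of _ O']) auto
qed

text \<open>A short curve in \<open>X\<close> from \<open>\<rho> y\<close> to \<open>x\<close>,
  lifted from \<open>y\<close>, ends in the fibre over \<open>x\<close>. So every point of the cover
  is within about the diameter of \<open>X\<close> of every fibre.\<close>

lemma near_fibre_point:
  assumes "y \<in> Xt" "x \<in> X" "dist (\<rho> y) x < r"
  obtains z where "z \<in> Xt" "\<rho> z = x" "d y z < r"
proof -
  have "\<rho> y \<in> X" using assms onto by blast
  then obtain c where c: "c \<in> curves_between X (\<rho> y) x" "curve_length c < ereal r"
    using short_curve assms by metis
  then have "path c" "path_image c \<subseteq> X" "pathstart c = \<rho> y" by (auto simp: curves_between_def)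
  then obtain k where k: "path k" "path_image k \<subseteq> Xt" "pathstart k = y" "\<And>t. t \<in> {0..1} \<Longrightarrow> \<rho> (k t) = c t"
    using covering_lift_path[OF cover assms(1)] by metis
  show ?thesis
  proof (rule that)
    show z: "pathfinish k \<in> Xt" using k by auto
    show "\<rho> (pathfinish k) = x" using k(4)[of 1] c(1) by (simp add: pathfinish_def curves_between_def)
    have "curve_length (\<rho> \<circ> k) < ereal r" using c(2) k(4) curve_length_cong[of "\<rho> \<circ> k" c] by simp
    then show "d y (pathfinish k) < r"
      unfolding d_less_iff[OF assms(1) z] using k by (auto simp: curves_between_def)
  qed
qed

subsection \<open>Deck transformations and fibres\<close>

text \<open>The path \<open>k\<close> lies over the same curve of \<open>X\<close> as
  \<open>\<gamma>\<close> but starts at \<open>z'\<close>; it is the image of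
  \<open>\<gamma>\<close> under the deck transformation constructed below.\<close>

definition lift_of :: "'b \<Rightarrow> (real \<Rightarrow> 'b) \<Rightarrow> (real \<Rightarrow> 'b) \<Rightarrow> bool"
  where "lift_of z' \<gamma> k \<longleftrightarrow> path k \<and> path_image k \<subseteq> Xt \<and> pathstart k = z' \<and> (\<forall>t\<in>{0..1}. \<rho> (k t) = \<rho> (\<gamma> t))"

lemma lift_of_exists:
  assumes "\<gamma> \<in> curves_between Xt z y" "z' \<in> Xt" "\<rho> z' = \<rho> z"
  obtains k where "lift_of z' \<gamma> k"
proof -
  have "\<rho> \<circ> \<gamma> \<in> curves_between X (\<rho> z) (\<rho> y)"
    using curves_between_compose[OF assms(1) cont] onto by simp
  then have "path (\<rho> \<circ> \<gamma>)" "path_image (\<rho> \<circ> \<gamma>) \<subseteq> X" "pathstart (\<rho> \<circ> \<gamma>) = \<rho> z'"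
    using assms(3) by (auto simp: curves_between_def)
  then obtain k where "path k" "path_image k \<subseteq> Xt" "pathstart k = z'" "\<And>t. t \<in> {0..1} \<Longrightarrow> \<rho> (k t) = (\<rho> \<circ> \<gamma>) t"
    using covering_lift_path[OF cover assms(2)] by metis
  then show ?thesis by (intro that[of k]) (simp add: lift_of_def)
qed

lemma lift_of_unique:
  assumes "lift_of z' \<gamma> k" "lift_of z' \<gamma> l" "t \<in> {0..1}"
  shows "k t = l t"
  by (rule covering_lift_path_unique[OF cover, of k l 0 t])
     (use assms in \<open>auto simp: lift_of_def pathstart_def\<close>)

lemma null_loop:
  assumes "l \<in> curves_between Xt z z"
  shows "homotopic_loops Xt l (\<lambda>_. z)"
  using simply assms curves_between_const[of z Xt] curves_between_endpoints[OF assms]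
  unfolding simply_connected_def curves_between_def by (auto 0 4)

text \<open>This makes \<open>deck\<close> well defined. The loop \<open>\<gamma>\<^sub>1\<close>
  followed by the reverse of \<open>\<gamma>\<^sub>2\<close> is null-homotopic, so its projection
  lifts from \<open>z'\<close> to a closed path \<open>k\<close>. The two halves of
  \<open>k\<close>, read from either end, are the lifts of the two curves, and both stop at
  \<open>k (1 / 2)\<close>.\<close>

lemma lift_of_end:
  assumes g: "\<gamma>\<^sub>1 \<in> curves_between Xt z y" "\<gamma>\<^sub>2 \<in> curves_between Xt z y"
    and k: "lift_of z' \<gamma>\<^sub>1 k\<^sub>1" "lift_of z' \<gamma>\<^sub>2 k\<^sub>2"
  shows "k\<^sub>1 1 = k\<^sub>2 1"
proof -
  define l where "l = \<gamma>\<^sub>1 +++ reversepath \<gamma>\<^sub>2"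
  have l: "l \<in> curves_between Xt z z"
    unfolding l_def using g by (intro curves_between_join curves_between_reversepath)
  have g0: "\<gamma>\<^sub>1 0 = z" "\<gamma>\<^sub>1 1 = \<gamma>\<^sub>2 1" using g by (auto simp: curves_between_def pathstart_def pathfinish_def)
  have z': "z' \<in> Xt" "\<rho> z' = \<rho> z"
    using k(1) g0 by (auto simp: lift_of_def pathstart_def path_image_def)
  obtain k where kl: "lift_of z' l k" using lift_of_exists[OF l z'] .
  then have kc: "k \<in> curves_between Xt z' (k 1)" by (auto simp: lift_of_def curves_between_def pathfinish_def)
  have "homotopic_loops X (\<rho> \<circ> l) (\<rho> \<circ> (\<lambda>_. z))"
    using null_loop[OF l] cont onto by (intro homotopic_loops_continuous_image) auto
  then have "homotopic_loops X (\<rho> \<circ> l) (\<lambda>_. \<rho> z)" by (simp add: o_def)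
  from covering_lift_null_loop_closed[OF cover this] kl
  have closed: "k 1 = k 0" by (auto simp: lift_of_def pathstart_def pathfinish_def)
  have k0: "k 0 = z'" using kl by (simp add: lift_of_def pathstart_def)
  have h1: "(\<lambda>t. k (t / 2)) \<in> curves_between Xt (k (0 / 2)) (k (1 / 2))"
    and h2: "(\<lambda>t. k (1 - t / 2)) \<in> curves_between Xt (k (1 - 0 / 2)) (k (1 - 1 / 2))"
    by (rule curves_between_reparametrize[OF kc]; auto intro!: continuous_intros)+
  have kl': "\<rho> (k t) = \<rho> (l t)" if "0 \<le> t" "t \<le> 1" for t using kl that by (simp add: lift_of_def)
  have "l (t / 2) = \<gamma>\<^sub>1 t" if "0 \<le> t" "t \<le> 1" for t
    using that by (simp add: l_def joinpaths_def)
  then have "lift_of z' \<gamma>\<^sub>1 (\<lambda>t. k (t / 2))"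
    using h1 k0 kl' by (auto simp: lift_of_def curves_between_def)
  from lift_of_unique[OF k(1) this, of 1] have 1: "k\<^sub>1 1 = k (1 / 2)" by simp
  have "l (1 - t / 2) = \<gamma>\<^sub>2 t" if "0 \<le> t" "t \<le> 1" for t
  proof (cases "t = 1")
    case True
    show ?thesis unfolding True using g0 by (simp add: l_def joinpaths_def)
  next
    case False
    then show ?thesis using that by (simp add: l_def joinpaths_def reversepath_def field_simps)
  qed
  then have "lift_of z' \<gamma>\<^sub>2 (\<lambda>t. k (1 - t / 2))"
    using h2 k0 closed kl' by (auto simp: lift_of_def curves_between_def)
  from lift_of_unique[OF k(2) this, of 1] have "k\<^sub>2 1 = k (1 / 2)" by simp
  with 1 show ?thesis by simp
qed

text \<open>
  The deck transformation taking \<open>z\<close> to \<open>z'\<close>; meaningful only if these lie in one fibre.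
  It is handled through its action on curves, so its continuity is never needed.
\<close>

definition deck :: "'b \<Rightarrow> 'b \<Rightarrow> 'b \<Rightarrow> 'b"
  where "deck z z' y = (SOME w. \<exists>\<gamma>\<in>curves_between Xt z y. \<exists>k. lift_of z' \<gamma> k \<and> w = k 1)"

lemma deck_eq:
  assumes "\<gamma> \<in> curves_between Xt z y" "lift_of z' \<gamma> k"
  shows "deck z z' y = k 1"
proof -
  have "\<exists>\<gamma>\<in>curves_between Xt z y. \<exists>k. lift_of z' \<gamma> k \<and> deck z z' y = k 1"
    unfolding deck_def by (rule someI[of _ "k 1"]) (use assms in blast)
  then show ?thesis using lift_of_end assms by metis
qed

lemma deck_along:
  assumes g: "\<gamma> \<in> curves_between Xt z y" and k: "lift_of z' \<gamma> k" and t: "t \<in> {0..1}"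
  shows "deck z z' (\<gamma> t) = k t"
proof -
  have kc: "k \<in> curves_between Xt z' (k 1)"
    using k by (auto simp: lift_of_def curves_between_def pathfinish_def)
  have c: "continuous_on {0..1} (\<lambda>s. t * s)" "(\<lambda>s. t * s) ` {0..1} \<subseteq> {0..1}"
    using t by (auto intro!: continuous_intros mult_le_one)
  have "(\<lambda>s. \<gamma> (t * s)) \<in> curves_between Xt z (\<gamma> t)"
    using curves_between_reparametrize[OF g c] g by (simp add: curves_between_def pathstart_def)
  moreover have "lift_of z' (\<lambda>s. \<gamma> (t * s)) (\<lambda>s. k (t * s))"
    using curves_between_reparametrize[OF kc c] k c(2)
    by (auto simp: lift_of_def curves_between_def pathstart_def image_subset_iff)
  ultimately show ?thesis using deck_eq by fastforce
qed

context
  fixes z z' assumes z: "z \<in> Xt" "z' \<in> Xt" "\<rho> z' = \<rho> z"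
begin

lemma deck_mem: "y \<in> Xt \<Longrightarrow> deck z z' y \<in> Xt"
  and deck_proj: "y \<in> Xt \<Longrightarrow> \<rho> (deck z z' y) = \<rho> y"
proof -
  assume y: "y \<in> Xt"
  obtain \<gamma> where g: "\<gamma> \<in> curves_between Xt z y" using exists_curve[OF z(1) y] .
  obtain k where k: "lift_of z' \<gamma> k" using lift_of_exists[OF g z(2,3)] .
  have "\<gamma> 1 = y" using g by (simp add: curves_between_def pathfinish_def)
  then show "deck z z' y \<in> Xt" "\<rho> (deck z z' y) = \<rho> y"
    unfolding deck_eq[OF g k] using k by (auto simp: lift_of_def path_image_def)
qed

lemma deck_base: "deck z z' z = z'"
proof -
  have "(\<lambda>_. z) \<in> curves_between Xt z z" using z(1) by (rule curves_between_const)
  moreover have "lift_of z' (\<lambda>_. z) (\<lambda>_. z')"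
    using z curves_between_const[OF z(2)] by (simp add: lift_of_def curves_between_def)
  ultimately show ?thesis by (rule deck_eq)
qed

text \<open>With a curve from \<open>z\<close> to \<open>p\<close> put in front, \<open>g\<close>
  becomes the second half of a curve from \<open>z\<close>. The lift of that curve is
  \<open>deck\<close> along it, which gives continuity along \<open>g\<close>.\<close>

lemma deck_curve:
  assumes g: "g \<in> curves_between Xt p q"
  shows "deck z z' \<circ> g \<in> curves_between Xt (deck z z' p) (deck z z' q)"
proof -
  have p: "p \<in> Xt" using curves_between_endpoints[OF g] by simp
  obtain \<gamma> where \<gamma>: "\<gamma> \<in> curves_between Xt z p" using exists_curve[OF z(1) p] .
  have j: "\<gamma> +++ g \<in> curves_between Xt z q" using \<gamma> g by (rule curves_between_join)
  obtain k where k: "lift_of z' (\<gamma> +++ g) k" using lift_of_exists[OF j z(2,3)] .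
  then have kc: "k \<in> curves_between Xt z' (k 1)"
    by (auto simp: lift_of_def curves_between_def pathfinish_def)
  have ends: "\<gamma> 1 = p" "g 0 = p" "g 1 = q" using \<gamma> g by (auto simp: curves_between_def pathstart_def pathfinish_def)
  have eq: "(deck z z' \<circ> g) t = k ((1 + t) / 2)" if t: "t \<in> {0..1}" for t
  proof -
    have "(\<gamma> +++ g) ((1 + t) / 2) = g t"
    proof (cases "t = 0")
      case True
      show ?thesis unfolding True using ends by (simp add: joinpaths_def)
    next
      case False
      then show ?thesis using t by (simp add: joinpaths_def field_simps)
    qed
    then show ?thesis using deck_along[OF j k, of "(1 + t) / 2"] t by simp
  qed
  have "(\<lambda>t. k ((1 + t) / 2)) \<in> curves_between Xt (k ((1 + 0) / 2)) (k ((1 + 1) / 2))"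
    by (rule curves_between_reparametrize[OF kc]) (auto intro!: continuous_intros)
  then have "path (\<lambda>t. k ((1 + t) / 2))" "path_image (\<lambda>t. k ((1 + t) / 2)) \<subseteq> Xt"
    by (auto simp: curves_between_def)
  moreover have "path (deck z z' \<circ> g) \<longleftrightarrow> path (\<lambda>t. k ((1 + t) / 2))"
    unfolding path_def by (rule continuous_on_cong) (use eq in auto)
  moreover have "path_image (deck z z' \<circ> g) = path_image (\<lambda>t. k ((1 + t) / 2))"
    unfolding path_image_def using eq by (intro image_cong) auto
  ultimately show ?thesis
    using ends by (simp add: curves_between_def pathstart_def pathfinish_def)
qed

text \<open>A curve and its image under \<open>deck\<close> have the same projection to
  \<open>X\<close>, hence the same length.\<close>

lemma deck_contracts:
  assumes p: "p \<in> Xt" "q \<in> Xt"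
  shows "d (deck z z' p) (deck z z' q) \<le> d p q"
proof (rule dense_ge)
  fix r assume "d p q < r"
  then obtain g where g: "g \<in> curves_between Xt p q" "curve_length (\<rho> \<circ> g) < ereal r"
    using d_less_iff[OF p] by blast
  have "curve_length (\<rho> \<circ> (deck z z' \<circ> g)) = curve_length (\<rho> \<circ> g)"
    using g(1) by (intro curve_length_cong) (auto simp: curves_between_def path_image_def intro!: deck_proj)
  then have "d (deck z z' p) (deck z z' q) < r"
    unfolding d_less_iff[OF deck_mem[OF p(1)] deck_mem[OF p(2)]]
    using g deck_curve[OF g(1)] by metis
  then show "d (deck z z' p) (deck z z' q) \<le> r" by simp
qed

end

text \<open>Lifting is symmetric: if \<open>k\<close> lifts \<open>\<gamma>\<close> from
  \<open>z'\<close>, then \<open>\<gamma>\<close> lifts \<open>k\<close> from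
  \<open>z\<close>.\<close>

lemma deck_inverse:
  assumes z: "z \<in> Xt" "z' \<in> Xt" "\<rho> z' = \<rho> z" and y: "y \<in> Xt"
  shows "deck z' z (deck z z' y) = y"
proof -
  obtain \<gamma> where g: "\<gamma> \<in> curves_between Xt z y" using exists_curve[OF z(1) y] .
  obtain k where k: "lift_of z' \<gamma> k" using lift_of_exists[OF g z(2,3)] .
  have "k \<in> curves_between Xt z' (deck z z' y)"
    using k deck_eq[OF g k] by (auto simp: lift_of_def curves_between_def pathfinish_def)
  moreover have "lift_of z k \<gamma>" using g k by (auto simp: lift_of_def curves_between_def)
  ultimately have "deck z' z (deck z z' y) = \<gamma> 1" by (rule deck_eq)
  then show ?thesis using g by (simp add: curves_between_def pathfinish_def)
qed

section \<open>Fibres and the order of the fundamental group\<close>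

definition fibre :: "'a \<Rightarrow> 'b set" where "fibre x = {z \<in> Xt. \<rho> z = x}"

text \<open>Send \<open>w\<close> to the class of the projection of a curve from a fixed
  \<open>w0\<close> to \<open>w\<close>. By monodromy the class determines the end point, so this
  map is injective.\<close>

lemma fibre_card_fundamental_group:
  assumes "x0 \<in> X" "finite (fundamental_group_set X x0)"
  shows "finite (fibre x0) \<and> card (fibre x0) \<le> card (fundamental_group_set X x0)"
proof -
  obtain w0 where w0: "w0 \<in> Xt" "\<rho> w0 = x0" using assms onto by blast
  have "\<exists>g. g \<in> curves_between Xt w0 w" if "w \<in> fibre x0" for w
    using exists_curve[OF w0(1), of w] that unfolding fibre_def by blast
  then obtain c where c: "\<And>w. w \<in> fibre x0 \<Longrightarrow> c w \<in> curves_between Xt w0 w" by metis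
  have rc: "\<rho> \<circ> c w \<in> curves_between X x0 x0" if "w \<in> fibre x0" for w
    using curves_between_compose[OF c[OF that] cont] onto that w0 by (auto simp: fibre_def)
  define F where "F w = {q. homotopic_paths X (\<rho> \<circ> c w) q}" for w
  have "inj_on F (fibre x0)"
  proof (rule inj_onI)
    fix v w assume vw: "v \<in> fibre x0" "w \<in> fibre x0" "F v = F w"
    have "\<rho> \<circ> c w \<in> F w"
      using rc[OF vw(2)] by (simp add: F_def curves_between_def)
    then have "homotopic_paths X (\<rho> \<circ> c v) (\<rho> \<circ> c w)" using vw(3) by (auto simp: F_def)
    from covering_monodromy[OF cover this] show "v = w"
      using c vw by (auto simp: curves_between_def)
  qed
  moreover have "F ` fibre x0 \<subseteq> fundamental_group_set X x0"
    using rc by (auto simp: F_def fundamental_group_set_def)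
  ultimately show ?thesis using assms(2) by (metis card_inj_on_le inj_on_finite)
qed

text \<open>Transport along the lifts of one fixed curve \<open>g\<close>; it is injective because
  lifts that share their end also share their start.\<close>

lemma fibre_inj:
  assumes "x \<in> X" "y \<in> X"
  obtains f where "inj_on f (fibre x)" "f ` fibre x \<subseteq> fibre y"
proof -
  obtain p q where pq: "p \<in> Xt" "\<rho> p = x" "q \<in> Xt" "\<rho> q = y" using assms onto by blast
  obtain g where g: "g \<in> curves_between Xt p q" using exists_curve[OF pq(1,3)] .
  have "\<exists>k. lift_of z g k" if "z \<in> fibre x" for z
    using lift_of_exists[OF g, of z] that pq by (auto simp: fibre_def)
  then obtain k where k: "\<And>z. z \<in> fibre x \<Longrightarrow> lift_of z g (k z)" by metis
  show ?thesis
  proof (rule that[of "\<lambda>z. k z 1"])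
    show "inj_on (\<lambda>z. k z 1) (fibre x)"
    proof (rule inj_onI)
      fix z w assume zw: "z \<in> fibre x" "w \<in> fibre x" "k z 1 = k w 1"
      have "k z 0 = k w 0"
        by (rule covering_lift_path_unique[OF cover, of "k z" "k w" 1 0])
           (use k[OF zw(1)] k[OF zw(2)] zw(3) in \<open>auto simp: lift_of_def\<close>)
      then show "z = w" using k zw by (auto simp: lift_of_def pathstart_def)
    qed
    have "g 1 = q" using g by (simp add: curves_between_def pathfinish_def)
    moreover have "k z 1 \<in> Xt" "\<rho> (k z 1) = \<rho> (g 1)" if "z \<in> fibre x" for z
      using k[OF that] by (auto simp: lift_of_def path_image_def)
    ultimately show "(\<lambda>z. k z 1) ` fibre x \<subseteq> fibre y"
      using pq by (auto simp: fibre_def)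
  qed
qed

lemma fibre_card:
  assumes "x0 \<in> X" "finite (fundamental_group_set X x0)" "x \<in> X"
  shows "finite (fibre x)" "card (fibre x) \<le> card (fundamental_group_set X x0)"
proof -
  obtain f where "inj_on f (fibre x)" "f ` fibre x \<subseteq> fibre x0" using fibre_inj assms by metis
  then show "finite (fibre x)" "card (fibre x) \<le> card (fundamental_group_set X x0)"
    using fibre_card_fundamental_group[OF assms(1,2)]
    by (meson inj_on_finite, meson card_inj_on_le le_trans)
qed

subsection \<open>Separation\<close>

text \<open>Suppose every piece \<open>A i\<close> is avoided by some curve
  \<open>\<alpha> i\<close> from \<open>a\<close> to \<open>b\<close>. Wrapping \<open>A i\<close>
  once around the circle and sending the rest to 1 gives a map \<open>h i\<close> whose winding
  along a curve counts crossings of \<open>A i\<close>. The loop made of a fixed \<open>g\<close>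
  and the reverse of \<open>\<alpha> i\<close> is null-homotopic, so \<open>g\<close> crosses every
  piece 0 times in total. But the crossing numbers of \<open>g\<close> add up to 1.\<close>

lemma slab_separation:
  fixes f :: "'b \<Rightarrow> real" and A :: "'i \<Rightarrow> 'b set"
  assumes f: "continuous_on Xt f" and \<delta>: "\<delta> > 0" and a: "a \<in> Xt" "f a \<le> t" and b: "b \<in> Xt" "f b \<ge> t + \<delta>"
    and I: "finite I" and A: "(\<Union>i\<in>I. A i) = {y \<in> Xt. t \<le> f y \<and> f y \<le> t + \<delta>}"
    and disj: "\<And>i j. i \<in> I \<Longrightarrow> j \<in> I \<Longrightarrow> i \<noteq> j \<Longrightarrow> A i \<inter> A j = {}"
    and op: "\<And>i. i \<in> I \<Longrightarrow> \<exists>W. openin (top_of_set Xt) W \<and> A i = W \<inter> {y \<in> Xt. t \<le> f y \<and> f y \<le> t + \<delta>}"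
  obtains i where "i \<in> I" "\<And>g. g \<in> curves_between Xt a b \<Longrightarrow> path_image g \<inter> A i \<noteq> {}"
proof (rule ccontr)
  assume "\<not> thesis"
  then have "\<forall>i\<in>I. \<exists>g\<in>curves_between Xt a b. path_image g \<inter> A i = {}" using that by blast
  then obtain \<alpha> where \<alpha>: "\<And>i. i \<in> I \<Longrightarrow> \<alpha> i \<in> curves_between Xt a b"
    "\<And>i. i \<in> I \<Longrightarrow> path_image (\<alpha> i) \<inter> A i = {}" by metis
  obtain g where g: "g \<in> curves_between Xt a b" using exists_curve[OF a(1) b(1)] .
  let ?slab = "{y \<in> Xt. t \<le> f y \<and> f y \<le> t + \<delta>}"
  have clf: "closedin (top_of_set Xt) (Xt \<inter> f -` T)" if "closed T" for T
    using f that by (rule continuous_closedin_preimage)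
  have "?slab = Xt \<inter> f -` {t..t+\<delta>}" by auto
  then have slab: "closedin (top_of_set Xt) ?slab" using clf[of "{t..t+\<delta>}"] by simp
  obtain W where W: "\<And>i. i \<in> I \<Longrightarrow> openin (top_of_set Xt) (W i)" "\<And>i. i \<in> I \<Longrightarrow> A i = W i \<inter> ?slab"
    using op by metis
  \<comment> \<open>The pieces are disjoint and relatively open in the slab, so each is the slab
    minus the open sets that cut out the others.\<close>
  have clA: "closedin (top_of_set Xt) (A i)" if i: "i \<in> I" for i
  proof -
    have "A i = ?slab - (\<Union>j\<in>I - {i}. W j)"
    proof (intro equalityI subsetI)
      fix y assume y: "y \<in> A i"
      then have "y \<in> ?slab" using A i by blast
      moreover have "y \<notin> W j" if "j \<in> I - {i}" for j
        using disj[of i j] i that y W(2)[of j] \<open>y \<in> ?slab\<close> by blast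
      ultimately show "y \<in> ?slab - (\<Union>j\<in>I - {i}. W j)" by blast
    next
      fix y assume y: "y \<in> ?slab - (\<Union>j\<in>I - {i}. W j)"
      then obtain j where j: "j \<in> I" "y \<in> A j" using A by blast
      then have "j = i" using y W(2)[of j] by blast
      then show "y \<in> A i" using j by simp
    qed
    moreover have "openin (top_of_set Xt) (\<Union>j\<in>I - {i}. W j)" using W(1) by (intro openin_Union) auto
    ultimately show ?thesis using slab by (simp add: closedin_diff)
  qed
  define e :: "'b \<Rightarrow> complex" where "e y = exp (2 * pi * \<i> * complex_of_real ((f y - t) / \<delta>))" for y
  have e1: "e y = 1" if "f y = t \<or> f y = t + \<delta>" for y
    using that \<delta> by (auto simp: e_def exp_two_pi_i)
  define h where "h i y = (if y \<in> A i then e y else 1)" for i y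
  have conth: "continuous_on Xt (h i)" if i: "i \<in> I" for i
  proof -
    \<comment> \<open>A closed set on which \<open>h i\<close> is 1: below the slab, above it, and
      the other pieces. It meets \<open>A i\<close> only at the levels \<open>t\<close> and
      \<open>t + \<delta>\<close>, where \<open>e\<close> is 1 too.\<close>
    define Q where "Q = (Xt \<inter> f -` {..t}) \<union> (Xt \<inter> f -` {t+\<delta>..}) \<union> (\<Union>j\<in>I - {i}. A j)"
    have AX: "A j \<subseteq> Xt" if "j \<in> I" for j using A that by blast
    have "A i \<union> Q = Xt"
    proof
      show "A i \<union> Q \<subseteq> Xt" using AX i by (auto simp: Q_def)
      show "Xt \<subseteq> A i \<union> Q"
      proof
        fix y assume y: "y \<in> Xt"
        show "y \<in> A i \<union> Q"
        proof (cases "y \<in> ?slab")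
          case True
          then obtain j where "j \<in> I" "y \<in> A j" using A by blast
          then show ?thesis by (auto simp: Q_def)
        next
          case False
          then show ?thesis using y by (auto simp: Q_def)
        qed
      qed
    qed
    moreover have "closedin (top_of_set Xt) Q"
      unfolding Q_def using I clA by (intro closedin_Un clf closedin_Union) auto
    moreover have "continuous_on (A i) e"
      unfolding e_def using continuous_on_subset[OF f AX[OF i]] \<delta>
      by (intro continuous_intros) auto
    moreover have "e y = 1" if "y \<in> Q" "y \<in> A i" for y
    proof -
      have "y \<in> ?slab" using A i that by blast
      moreover have "y \<notin> A j" if "j \<in> I - {i}" for j using disj[of i j] i that \<open>y \<in> A i\<close> by blast
      ultimately show ?thesis using that(1) by (intro e1) (auto simp: Q_def)
    qed
    ultimately have "continuous_on (A i \<union> Q) (\<lambda>y. if y \<in> A i then e y else 1)"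
      using clA[OF i] by (intro continuous_on_cases_local) auto
    then show ?thesis using \<open>A i \<union> Q = Xt\<close> by (simp add: h_def[abs_def])
  qed
  have ha: "h i a = 1" and hb: "h i b = 1" if "i \<in> I" for i
  proof -
    have "f y \<in> {t..t+\<delta>}" if "y \<in> A i" for y using A \<open>i \<in> I\<close> that by auto
    from this[of a] this[of b] show "h i a = 1" "h i b = 1"
      using a b e1[of a] e1[of b] by (auto simp: h_def)
  qed
  have hn: "h i ` Xt \<subseteq> - {0}" for i by (auto simp: h_def e_def)
  note cexp = covering_space_exp_punctured_plane
  \<comment> \<open>A continuous logarithm of \<open>h i\<close> along \<open>g\<close>; its end
    value is 2 pi i times the crossing number.\<close>
  have "\<exists>l. path l \<and> l 0 = 0 \<and> (\<forall>s\<in>{0..1}. exp (l s) = h i (g s))" if i: "i \<in> I" for i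
  proof -
    have "h i \<circ> g \<in> curves_between (- {0}) 1 1"
      using curves_between_compose[OF g conth[OF i] hn] ha hb i by simp
    then have "path (h i \<circ> g)" "path_image (h i \<circ> g) \<subseteq> - {0}" "pathstart (h i \<circ> g) = exp 0"
      by (auto simp: curves_between_def)
    then show ?thesis using covering_lift_path[OF cexp UNIV_I, of "h i \<circ> g" 0]
      by (metis comp_apply pathstart_def)
  qed
  then obtain l where l: "\<And>i. i \<in> I \<Longrightarrow> path (l i)" "\<And>i. i \<in> I \<Longrightarrow> l i 0 = 0"
    "\<And>i s. i \<in> I \<Longrightarrow> s \<in> {0..1} \<Longrightarrow> exp (l i s) = h i (g s)" by metis
  have l1: "l i 1 = 0" if i: "i \<in> I" for i
  proof -
    define c where "c = g +++ reversepath (\<alpha> i)"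
    have c: "c \<in> curves_between Xt a a"
      unfolding c_def using g \<alpha>(1)[OF i] by (intro curves_between_join curves_between_reversepath)
    have "homotopic_loops (- {0}) (h i \<circ> c) (h i \<circ> (\<lambda>_. a))"
      using null_loop[OF c] conth[OF i] hn[of i] by (intro homotopic_loops_continuous_image) auto
    then have hom: "homotopic_loops (- {0}) (h i \<circ> c) (\<lambda>_. h i a)" by (simp add: o_def)
    \<comment> \<open>Along the reversed \<open>\<alpha> i\<close> the map \<open>h i\<close> is
      constantly 1, so the logarithm continues as a constant.\<close>
    have "pathfinish (l i +++ (\<lambda>_. l i 1)) = pathstart (l i +++ (\<lambda>_. l i 1))"
    proof (rule covering_lift_null_loop_closed[OF cexp hom])
      show "path (l i +++ (\<lambda>_. l i 1))"
        using l(1)[OF i] by (intro path_join_imp) (auto simp: path_def pathfinish_def pathstart_def)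
      fix s :: real assume s: "s \<in> {0..1}"
      have "h i (reversepath (\<alpha> i) (2 * s - 1)) = 1" if "\<not> s \<le> 1/2"
      proof -
        have "reversepath (\<alpha> i) (2 * s - 1) \<in> path_image (\<alpha> i)"
          using s that by (auto simp: reversepath_def path_image_def)
        then show ?thesis using \<alpha>(2)[OF i] by (auto simp: h_def)
      qed
      moreover have "g 1 = b" using g by (simp add: curves_between_def pathfinish_def)
      ultimately show "exp ((l i +++ (\<lambda>_. l i 1)) s) = (h i \<circ> c) s"
        using s l(3)[OF i, of "2 * s"] l(3)[OF i, of 1] hb[OF i] by (simp add: joinpaths_def c_def)
    qed simp
    then show ?thesis using l(2)[OF i] by (simp add: joinpaths_def pathfinish_def pathstart_def)
  qed
  define u where "u y = max 0 (min 1 ((f y - t) / \<delta>))" for y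
  \<comment> \<open>At each point at most one factor differs from 1. The clamped height
    \<open>u\<close>, times 2 pi i, is therefore a logarithm of the product on all of
    \<open>Xt\<close>.\<close>
  have prod: "(\<Prod>i\<in>I. h i y) = exp (2 * pi * \<i> * complex_of_real (u y))" if y: "y \<in> Xt" for y
  proof (cases "y \<in> ?slab")
    case True
    then obtain j where j: "j \<in> I" "y \<in> A j" using A by blast
    have "(\<Prod>i\<in>I. h i y) = (\<Prod>i\<in>{j}. h i y)"
      using I j disj by (intro prod.mono_neutral_right) (auto simp: h_def)
    moreover have "u y = (f y - t) / \<delta>" using True \<delta> by (simp add: u_def)
    ultimately show ?thesis using j by (simp add: h_def e_def)
  next
    case False
    then have "(\<Prod>i\<in>I. h i y) = 1" using A by (intro prod.neutral) (auto simp: h_def)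
    moreover have "u y = 0 \<or> u y = 1"
      using False y \<delta> by (auto simp: u_def max_def min_def field_simps)
    ultimately show ?thesis using exp_two_pi_i by auto
  qed
  have gX: "g s \<in> Xt" if "s \<in> {0..1}" for s
    using g that by (auto simp: curves_between_def path_image_def)
  have ends: "g 0 = a" "g 1 = b" using g by (auto simp: curves_between_def pathstart_def pathfinish_def)
  have "continuous_on {0..1} g" using g by (simp add: curves_between_def path_def)
  then have "continuous_on {0..1} (\<lambda>s. f (g s))"
    using gX by (intro continuous_on_compose2[OF f]) auto
  then have cu: "continuous_on {0..1} (\<lambda>s. u (g s))"
    unfolding u_def using \<delta> by (intro continuous_intros) auto
  \<comment> \<open>Both sides come from logarithms of the product along \<open>g\<close> that start
    at 0, so they agree; the right one ends at 2 pi i.\<close>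
  have "(\<Sum>i\<in>I. l i 1) = 2 * pi * \<i> * complex_of_real (u (g 1))"
  proof (rule covering_lift_path_unique[OF cexp, where s = 0 and t = 1
        and k = "\<lambda>s. \<Sum>i\<in>I. l i s" and l = "\<lambda>s. 2 * pi * \<i> * complex_of_real (u (g s))"])
    show "path (\<lambda>s. \<Sum>i\<in>I. l i s)"
      using l(1) unfolding path_def by (intro continuous_intros) auto
    show "path (\<lambda>s. 2 * pi * \<i> * complex_of_real (u (g s)))"
      unfolding path_def using cu by (intro continuous_intros) auto
    show "exp (\<Sum>i\<in>I. l i s) = exp (2 * pi * \<i> * complex_of_real (u (g s)))" if "s \<in> {0..1}" for s
      using l(3) I that prod[OF gX[OF that]] by (simp add: exp_sum)
    have "(f a - t) / \<delta> \<le> 0" using a \<delta> by (simp add: divide_nonpos_pos)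
    then have "u a = 0" by (simp add: u_def)
    then show "(\<Sum>i\<in>I. l i 0) = 2 * pi * \<i> * complex_of_real (u (g 0))"
      using l(2) ends by simp
  qed auto
  moreover have "u b = 1" using b \<delta> by (simp add: u_def le_divide_eq)
  ultimately show False using l1 ends by simp
qed

text \<open>One hypothesis serves twice: with \<open>c = y\<close> it shows that \<open>C\<close> is
  open, with \<open>y' = y\<close> that its complement is.\<close>

lemma small_balls_clopen:
  assumes C: "C \<subseteq> Xt" "C \<noteq> {}" and \<eta>: "\<eta> > 0"
    and ball: "\<And>y c y'. y \<in> Xt \<Longrightarrow> c \<in> C \<Longrightarrow> d y c < \<eta> \<Longrightarrow> y' \<in> Xt \<Longrightarrow> d y y' < \<eta> \<Longrightarrow> y' \<in> C"
  shows "C = Xt"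
proof -
  have 1: "openin (top_of_set Xt) C"
  proof (subst openin_subopen, intro ballI)
    fix y assume y: "y \<in> C"
    then have yX: "y \<in> Xt" using C by blast
    obtain V where V: "openin (top_of_set Xt) V" "y \<in> V" "\<And>y'. y' \<in> V \<Longrightarrow> d y y' < \<eta>"
      using d_nbhd[OF yX \<eta>] by metis
    then show "\<exists>V. openin (top_of_set Xt) V \<and> y \<in> V \<and> V \<subseteq> C"
      using ball[OF yX y] d_refl[OF yX] \<eta> openin_imp_subset[OF V(1)] by (intro exI[of _ V]) auto
  qed
  have 2: "openin (top_of_set Xt) (Xt - C)"
  proof (subst openin_subopen, intro ballI)
    fix y assume y: "y \<in> Xt - C"
    then have yX: "y \<in> Xt" by blast
    obtain V where V: "openin (top_of_set Xt) V" "y \<in> V" "\<And>y'. y' \<in> V \<Longrightarrow> d y y' < \<eta>"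
      using d_nbhd[OF yX \<eta>] by metis
    have "v \<notin> C" if "v \<in> V" for v
      using ball[OF yX _ V(3)[OF that] yX] d_refl[OF yX] \<eta> y by auto
    then show "\<exists>V. openin (top_of_set Xt) V \<and> y \<in> V \<and> V \<subseteq> Xt - C"
      using V openin_imp_subset[OF V(1)] by (intro exI[of _ V]) auto
  qed
  have "connected Xt" using conn by (rule path_connected_imp_connected)
  then have "C = {} \<or> C = Xt"
    using 1 2 C unfolding connected_clopen closedin_def by auto
  with C show ?thesis by blast
qed

section \<open>Path components of complements and translates of a separator\<close>

lemma path_component_iff_curve: "path_component S x y \<longleftrightarrow> curves_between S x y \<noteq> {}"
  by (auto simp: path_component_def curves_between_def)

lemma ball_path_component:
  assumes "y \<in> Xt" "y' \<in> Xt" "d y y' < \<eta>"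
  shows "path_component {x \<in> Xt. d y x < \<eta>} y y'"
proof -
  obtain g where g: "g \<in> curves_between Xt y y'" "\<And>x. x \<in> path_image g \<Longrightarrow> d y x + d x y' < \<eta>"
    using d_curve[OF assms] by metis
  have "path_image g \<subseteq> {x \<in> Xt. d y x < \<eta>}"
  proof
    fix x assume "x \<in> path_image g"
    then show "x \<in> {x \<in> Xt. d y x < \<eta>}"
      using g(1) g(2)[of x] d_nonneg[of x y'] by (auto simp: curves_between_def)
  qed
  then show ?thesis using g(1) unfolding path_component_def curves_between_def by blast
qed

lemma deck_path_component:
  assumes "z \<in> Xt" "z' \<in> Xt" "\<rho> z' = \<rho> z" "T \<subseteq> Xt" "path_component T x y"
  shows "path_component (deck z z' ` T) (deck z z' x) (deck z z' y)"
proof -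
  obtain g where g: "g \<in> curves_between T x y" using assms(5) by (auto simp: path_component_iff_curve)
  then have "g \<in> curves_between Xt x y" using assms(4) by (auto simp: curves_between_def)
  from deck_curve[OF assms(1-3) this] have "deck z z' \<circ> g \<in> curves_between (deck z z' ` T) (deck z z' x) (deck z z' y)"
    using g by (auto simp: curves_between_def path_image_compose)
  then show ?thesis by (auto simp: path_component_iff_curve)
qed

text \<open>Let \<open>g\<close> take \<open>z\<close> to \<open>a\<close>, and let \<open>U\<close>
  be the component of \<open>a\<close> off \<open>S\<close>. The translate of \<open>S\<close>
  contains \<open>a\<close> and misses \<open>S\<close>, so it lies in \<open>U\<close>, and all
  points outside \<open>U\<close> are joined to \<open>z\<close> around it. The translate separates
  \<open>g a\<close> from \<open>g b\<close>, so one of them, \<open>g c\<close>, is cut off from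
  \<open>z\<close>, and \<open>g\<close> maps the component \<open>V\<close> of \<open>c\<close>
  into \<open>U\<close> minus \<open>a\<close>. Thus \<open>V\<close> has fewer fibre points than
  \<open>U\<close>: absurd for \<open>c = a\<close>, and against \<open>le\<close> for
  \<open>c = b\<close>.\<close>

lemma no_small_separator_half:
  assumes F: "finite (fibre x)" and a: "a \<in> fibre x" and z: "z \<in> fibre x" "z \<in> S"
    and b: "b \<in> Xt" "b \<notin> S" and S: "S \<subseteq> Xt" "path_connected S"
    and sep: "\<not> path_component (Xt - S) a b"
    and \<eta>: "\<eta> > 0" and gap: "\<And>s s'. s \<in> S \<Longrightarrow> s' \<in> S \<Longrightarrow> \<eta> \<le> d s (deck z a s')"
    and le: "card (fibre x \<inter> path_component_set (Xt - S) a) \<le> card (fibre x \<inter> path_component_set (Xt - S) b)"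
  shows False
proof -
  define g where "g = deck z a"
  define U where "U = path_component_set (Xt - S) a"
  have zX: "z \<in> Xt" "a \<in> Xt" "\<rho> a = \<rho> z" "\<rho> z = \<rho> a" using a z by (auto simp: fibre_def)
  note zz = zX(1,2,3) and zz' = zX(2,1,4)
  have gX: "g y \<in> Xt" if "y \<in> Xt" for y unfolding g_def using deck_mem[OF zz] that .
  have gz: "g z = a" unfolding g_def by (rule deck_base[OF zz])
  have inv: "deck a z (g y) = y" "g (deck a z y) = y" if "y \<in> Xt" for y
    unfolding g_def using deck_inverse[OF zz that] deck_inverse[OF zz' that] by auto
  have ginj: "u = v" if "g u = g v" "u \<in> Xt" "v \<in> Xt" for u v using that inv by metis
  have gSX: "g ` S \<subseteq> Xt" using gX S by blast
  have dj: "S \<inter> g ` S = {}"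
  proof (rule ccontr)
    assume "S \<inter> g ` S \<noteq> {}"
    then obtain s where "s \<in> S" "g s \<in> S" by blast
    then show False using gap[of "g s" s] \<eta> d_refl[of "g s"] S by (auto simp: g_def)
  qed
  have Sconn: "path_component S s s'" if "s \<in> S" "s' \<in> S" for s s'
    using S(2) that by (simp add: path_connected_component)
  have gSU: "g ` S \<subseteq> U"
  proof clarify
    fix s assume "s \<in> S"
    then have "path_component (g ` S) a (g s)"
      using deck_path_component[OF zz S(1) Sconn[OF z(2)]] gz by (simp add: g_def)
    then have "path_component (Xt - S) a (g s)"
      by (rule path_component_of_subset[rotated]) (use gSX dj in auto)
    then show "g s \<in> U" by (simp add: U_def)
  qed
  have aU: "a \<in> U" using gSU gz z(2) by blast
  have out: "path_component (Xt - g ` S) w z" if w: "w \<in> Xt" "w \<notin> U" for w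
  proof (rule ccontr)
    assume neg: "\<not> path_component (Xt - g ` S) w z"
    have SS: "S \<subseteq> Xt - g ` S" using S dj by auto
    have "w \<notin> S" using neg Sconn[of w z] z(2) path_component_of_subset[OF SS] by blast
    define C where "C = path_component_set (Xt - S) w"
    have wC: "w \<in> C" using w \<open>w \<notin> S\<close> by (simp add: C_def path_component_refl)
    have CX: "C \<subseteq> Xt - S" unfolding C_def by (rule path_component_subset)
    have "C \<inter> U = {}"
      using w(2) unfolding C_def U_def by (auto dest: path_component_sym intro: path_component_trans)
    then have CgS: "C \<subseteq> Xt - g ` S" using gSU CX by blast
    have Cw: "path_component (Xt - g ` S) w c" if "c \<in> C" for c
    proof -
      have "path_component C w c"
        using that wC path_connected_path_component[of "Xt - S" w] unfolding path_connected_component C_def by blast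
      then show ?thesis using path_component_of_subset[OF CgS] by blast
    qed
    have "C = Xt"
    \<comment> \<open>The radius is half the gap, so no such ball meets both \<open>S\<close> and
      its translate. A ball meeting \<open>C\<close> and \<open>S\<close> would therefore link
      \<open>w\<close> to \<open>z\<close> off the translate.\<close>
    proof (rule small_balls_clopen[of C "\<eta> / 2"])
      fix y c y' assume y: "y \<in> Xt" "c \<in> C" "d y c < \<eta> / 2" "y' \<in> Xt" "d y y' < \<eta> / 2"
      define B where "B = {u \<in> Xt. d y u < \<eta> / 2}"
      have Bconn: "path_component B u v" if "u \<in> B" "v \<in> B" for u v
        using ball_path_component[OF y(1), of u "\<eta> / 2"] ball_path_component[OF y(1), of v "\<eta> / 2"] that
        unfolding B_def by (auto intro: path_component_trans path_component_sym)
      have cB: "c \<in> B" "y' \<in> B" using y CX by (auto simp: B_def)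
      have "B \<inter> S = {}"
      proof (rule ccontr)
        assume "B \<inter> S \<noteq> {}"
        then obtain s where s: "s \<in> B" "s \<in> S" by blast
        have "B \<inter> g ` S = {}"
        proof (rule ccontr)
          assume "B \<inter> g ` S \<noteq> {}"
          then obtain s' where s': "s' \<in> S" "g s' \<in> B" by blast
          have "\<eta> \<le> d s (g s')" using gap[OF s(2) s'(1)] by (simp add: g_def)
          also have "\<dots> \<le> d s y + d y (g s')" using s s' y by (intro d_triangle) (auto simp: B_def)
          also have "\<dots> < \<eta>" using s s' d_sym[of s y] by (auto simp: B_def)
          finally show False by simp
        qed
        then have "B \<subseteq> Xt - g ` S" by (auto simp: B_def)
        then have "path_component (Xt - g ` S) c s"
          using Bconn[OF cB(1) s(1)] path_component_of_subset by blast
        moreover have "path_component (Xt - g ` S) s z"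
          using Sconn[OF s(2) z(2)] path_component_of_subset[OF SS] by blast
        ultimately show False using neg Cw[OF y(2)] path_component_trans by metis
      qed
      then have "B \<subseteq> Xt - S" by (auto simp: B_def)
      then have "path_component (Xt - S) c y'" using Bconn[OF cB] path_component_of_subset by blast
      then show "y' \<in> C" using y(2) unfolding C_def by (auto intro: path_component_trans)
    qed (use CX wC \<eta> in auto)
    then show False using CX z(2) zX(1) by blast
  qed
  have gsub: "g ` (Xt - S) \<subseteq> Xt - g ` S"
    using gX ginj S by blast
  \<comment> \<open>The inverse deck transformation would turn a connection here into one from
    \<open>a\<close> to \<open>b\<close> off \<open>S\<close>.\<close>
  have "\<not> path_component (Xt - g ` S) (g a) (g b)"
  proof
    assume "path_component (Xt - g ` S) (g a) (g b)"
    from deck_path_component[OF zz' _ this]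
    have "path_component (deck a z ` (Xt - g ` S)) a b" using inv zX b by simp
    moreover have "deck a z ` (Xt - g ` S) \<subseteq> Xt - S"
      using inv(2) deck_mem[OF zz'] by force
    ultimately show False using sep path_component_of_subset by blast
  qed
  then obtain c where c: "c = a \<or> c = b" "\<not> path_component (Xt - g ` S) (g c) z"
    using path_component_trans path_component_sym by metis
  define V where "V = path_component_set (Xt - S) c"
  have VX: "V \<subseteq> Xt - S" unfolding V_def by (rule path_component_subset)
  \<comment> \<open>Since \<open>a = g z\<close> with \<open>z\<close> in \<open>S\<close>, while
    \<open>V\<close> misses \<open>S\<close>, the point \<open>a\<close> is not hit; this makes the
    comparison of counts strict.\<close>
  have gV: "g y \<in> U \<and> g y \<noteq> a" if "y \<in> V" for y
  proof
    have "path_component (g ` (Xt - S)) (g c) (g y)"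
      using deck_path_component[OF zz, of "Xt - S" c y] that by (simp add: V_def g_def)
    then have "path_component (Xt - g ` S) (g c) (g y)"
      using gsub path_component_of_subset by blast
    then show "g y \<in> U" using out[of "g y"] c(2) gX[of y] VX that path_component_trans by blast
    show "g y \<noteq> a" using ginj[of y z] gz VX that z(2) zX(1) by auto
  qed
  have "g ` (fibre x \<inter> V) \<subseteq> (fibre x \<inter> U) - {a}"
    using gV gX deck_proj[OF zz] VX by (auto simp: fibre_def g_def)
  then have "card (g ` (fibre x \<inter> V)) \<le> card ((fibre x \<inter> U) - {a})"
    using F by (intro card_mono) auto
  also have "\<dots> < card (fibre x \<inter> U)" using F aU a by (intro card_Diff1_less) auto
  finally have "card (g ` (fibre x \<inter> V)) < card (fibre x \<inter> U)" .
  moreover have "inj_on g (fibre x \<inter> V)" by (rule inj_onI) (auto simp: fibre_def intro: ginj)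
  ultimately have "card (fibre x \<inter> V) < card (fibre x \<inter> U)" by (simp add: card_image)
  then show False using c(1) le unfolding U_def V_def by auto
qed

text \<open>Start from whichever of \<open>a\<close> and \<open>b\<close> has no more fibre points
  on its side than the other. The gaps at \<open>s' = z\<close> also keep \<open>a\<close> and
  \<open>b\<close> off \<open>S\<close>.\<close>

lemma no_small_separator:
  assumes F: "finite (fibre x)" and a: "a \<in> fibre x" and b: "b \<in> fibre x" and z: "z \<in> fibre x" "z \<in> S"
    and S: "S \<subseteq> Xt" "path_connected S"
    and sep: "\<And>g. g \<in> curves_between Xt a b \<Longrightarrow> path_image g \<inter> S \<noteq> {}"
    and \<eta>: "\<eta> > 0"
    and gap_a: "\<And>s s'. s \<in> S \<Longrightarrow> s' \<in> S \<Longrightarrow> \<eta> \<le> d s (deck z a s')"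
    and gap_b: "\<And>s s'. s \<in> S \<Longrightarrow> s' \<in> S \<Longrightarrow> \<eta> \<le> d s (deck z b s')"
  shows False
proof -
  have X: "a \<in> Xt" "b \<in> Xt" "z \<in> Xt" "\<rho> a = \<rho> z" "\<rho> b = \<rho> z" using a b z by (auto simp: fibre_def)
  have nS: "a \<notin> S" "b \<notin> S"
    using gap_a[of a z] gap_b[of b z] z(2) \<eta> X d_refl deck_base by auto
  have s: "\<not> path_component (Xt - S) a b"
    using sep unfolding path_component_def curves_between_def by blast
  then have s': "\<not> path_component (Xt - S) b a" using path_component_sym by metis
  show False
    using no_small_separator_half[OF F a z X(2) nS(2) S s \<eta> gap_a]
      no_small_separator_half[OF F b z X(1) nS(1) S s' \<eta> gap_b] by linarith
qed

subsection \<open>Counting fibre points\<close>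

text \<open>\<open>K\<close> is the class of a piece that separates \<open>a\<close> from
  \<open>b\<close>. Its points are chained by overlapping \<open>D\<close>-balls, so a class with
  few points has small extent. If that extent were small against both \<open>t\<close> and
  \<open>d a b - t\<close>, a connected separator could be moved off itself to \<open>a\<close> and
  to \<open>b\<close>, which \<open>no_small_separator\<close> forbids.\<close>

lemma slab_piece:
  assumes F: "finite (fibre x)" and a: "a \<in> fibre x" and b: "b \<in> fibre x"
    and near: "\<And>y. y \<in> Xt \<Longrightarrow> \<exists>z\<in>fibre x. d z y < D"
    and t: "t \<ge> 0" and \<delta>: "\<delta> > 0" and tL: "t + \<delta> \<le> d a b"
  obtains K where "K \<subseteq> fibre x" "card K \<ge> 1"
    "\<And>z. z \<in> K \<Longrightarrow> t - D < d a z \<and> d a z < t + \<delta> + D"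
    "\<not> (2 * D * card K + \<delta> \<le> t \<and> 2 * D * card K + \<delta> \<le> d a b - t - \<delta>)"
proof -
  have X: "a \<in> Xt" "b \<in> Xt" and FX: "\<And>z. z \<in> fibre x \<Longrightarrow> z \<in> Xt" using a b by (auto simp: fibre_def)
  define A where "A = {y \<in> Xt. t \<le> d a y \<and> d a y \<le> t + \<delta>}"
  have AX: "w \<in> Xt" if "w \<in> A" for w using that by (simp add: A_def)
  define N where "N = {z \<in> fibre x. \<exists>w\<in>A. d z w < D}"
  define R where "R = {(z, z'). z \<in> fibre x \<and> z' \<in> fibre x \<and> (\<exists>w\<in>A. d z w < D \<and> d z' w < D)}"
  define P where "P z = {w \<in> A. \<exists>z'. (z, z') \<in> R\<^sup>* \<and> z' \<in> N \<and> d z' w < D}" for z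
  have symR: "sym R" by (auto simp: R_def sym_def)
  have symRs: "(z', z) \<in> R\<^sup>*" if "(z, z') \<in> R\<^sup>*" for z z' using symR that by (meson sym_rtrancl symD)
  \<comment> \<open>Pieces serve as their own indices, so no representatives of classes are
    chosen.\<close>
  define I where "I = P ` N"
  have Peq: "P z = P z'" if "(z, z') \<in> R\<^sup>*" for z z'
    using that symRs[OF that] unfolding P_def by (auto intro: rtrancl_trans)
  have finI: "finite I" unfolding I_def N_def using F by auto
  have cover: "(\<Union>i\<in>I. i) = A"
  proof
    show "(\<Union>i\<in>I. i) \<subseteq> A" by (auto simp: I_def P_def)
    show "A \<subseteq> (\<Union>i\<in>I. i)"
    proof
      fix w assume w: "w \<in> A"
      obtain z where "z \<in> fibre x" "d z w < D" using near[OF AX[OF w]] by blast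
      then have "z \<in> N" "w \<in> P z" using w by (auto simp: N_def P_def)
      then show "w \<in> (\<Union>i\<in>I. i)" by (auto simp: I_def)
    qed
  qed
  have disj: "i \<inter> j = {}" if ij: "i \<in> I" "j \<in> I" "i \<noteq> j" for i j
  proof (rule ccontr)
    assume "i \<inter> j \<noteq> {}"
    then obtain w where w: "w \<in> i" "w \<in> j" by blast
    obtain z1 z2 where z: "i = P z1" "j = P z2" using ij by (auto simp: I_def)
    obtain y1 y2 where y: "(z1, y1) \<in> R\<^sup>*" "y1 \<in> N" "d y1 w < D" "(z2, y2) \<in> R\<^sup>*" "y2 \<in> N" "d y2 w < D" "w \<in> A"
      using w unfolding z P_def by blast
    then have "(y1, y2) \<in> R" by (auto simp: R_def N_def)
    then have "(z1, z2) \<in> R\<^sup>*" using y symRs by (meson rtrancl.rtrancl_into_rtrancl rtrancl_trans)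
    then show False using Peq z ij(3) by blast
  qed
  have op: "\<exists>W. openin (top_of_set Xt) W \<and> i = W \<inter> A" if i: "i \<in> I" for i
  proof -
    obtain z where z: "i = P z" using i by (auto simp: I_def)
    define W where "W = (\<Union>z'\<in>{z' \<in> N. (z, z') \<in> R\<^sup>*}. Xt \<inter> d z' -` {..<D})"
    have "openin (top_of_set Xt) W"
      unfolding W_def
      by (rule openin_Union) (auto simp: N_def intro!: continuous_openin_preimage_gen continuous_d FX)
    moreover have "i = W \<inter> A" unfolding z P_def W_def using AX by auto
    ultimately show ?thesis by blast
  qed
  obtain i where i: "i \<in> I" and sep: "\<And>g. g \<in> curves_between Xt a b \<Longrightarrow> path_image g \<inter> i \<noteq> {}"
  proof (rule slab_separation[OF continuous_d[OF X(1)] \<delta> X(1) _ X(2) tL finI, of "\<lambda>i. i"])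
    show "d a a \<le> t" using d_refl[OF X(1)] t by simp
  qed (use cover disj op in \<open>auto simp: A_def\<close>)
  obtain z0 where z0: "z0 \<in> N" "i = P z0" using i by (auto simp: I_def)
  define K where "K = {z \<in> N. (z0, z) \<in> R\<^sup>*}"
  have KF: "K \<subseteq> fibre x" by (auto simp: K_def N_def)
  have finK: "finite K" using F KF finite_subset by blast
  have z0K: "z0 \<in> K" using z0 by (simp add: K_def)
  have Kpos: "card K \<ge> 1" using z0K finK by (auto simp: Suc_le_eq card_gt_0_iff)
  have near_K: "\<exists>w\<in>A. d z w < D" if "z \<in> K" for z using that by (auto simp: K_def N_def)
  have Dpos: "D > 0" using near_K[OF z0K] d_nonneg by (meson le_less_trans)
  have reachK: "y \<in> K" if "(z0, y) \<in> R\<^sup>*" for y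
    using that by cases (use z0 that in \<open>auto simp: K_def N_def R_def\<close>)
  have reachR: "(z0, y) \<in> (R \<inter> K \<times> K)\<^sup>*" if "(z0, y) \<in> R\<^sup>*" for y
    using that
  proof induction
    case (step y y')
    then have "(y, y') \<in> R \<inter> K \<times> K" using reachK by (auto intro: rtrancl_into_rtrancl)
    with step.IH show ?case by (rule rtrancl_into_rtrancl)
  qed simp
  \<comment> \<open>Neighbours under \<open>R\<close> are less than \<open>2 * D\<close> apart,
    through a slab point \<open>w\<close> common to their balls.\<close>
  have bound: "d z0 z \<le> 2 * D * (real (card K) - 1)" if z: "z \<in> K" for z
  proof (rule chain_card_bound[OF finK z0K, where R = "R \<inter> K \<times> K"])
    show "d z0 y' \<le> d z0 y + 2 * D" if yR: "(y, y') \<in> R \<inter> K \<times> K" for y y'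
    proof -
      obtain w where w: "w \<in> A" "d y w < D" "d y' w < D" using yR by (auto simp: R_def)
      have X': "y \<in> Xt" "y' \<in> Xt" "z0 \<in> Xt" "w \<in> Xt" using yR KF FX z0K AX w by auto
      show ?thesis
        using d_triangle[OF X'(3,1,2)] d_triangle[OF X'(1,4,2)] w d_sym[of w y'] by linarith
    qed
  qed (use reachR z Dpos KF FX z0K d_refl in \<open>auto simp: K_def\<close>)
  \<comment> \<open>The points on almost shortest curves from \<open>K\<close> to the slab. This set
    is path connected, contains the piece and \<open>K\<close>, and stays within \<open>D\<close> of
    the slab; full \<open>D\<close>-balls would only stay within \<open>2 * D\<close>.\<close>
  define S where "S = {y \<in> Xt. \<exists>z\<in>K. \<exists>w\<in>A. d z y + d y w < D}"
  have SX: "S \<subseteq> Xt" by (auto simp: S_def)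
  have AS: "i \<subseteq> S"
    using z0(2) AX by (force simp: S_def P_def K_def d_refl)
  have KS: "K \<subseteq> S" using near_K KF FX d_refl by (force simp: S_def)
  have to_K: "path_component S z y" if zy: "z \<in> K" "y \<in> Xt" "w \<in> A" "d z y + d y w < D" for z y w
  proof -
    have zX: "z \<in> Xt" using zy KF FX by auto
    have "d z y < D - d y w" using zy by simp
    then obtain g where g: "g \<in> curves_between Xt z y" "\<And>v. v \<in> path_image g \<Longrightarrow> d z v + d v y < D - d y w"
      using d_curve[OF zX zy(2)] by metis
    have "path_image g \<subseteq> S"
    proof
      fix v assume v: "v \<in> path_image g"
      then have vX: "v \<in> Xt" using g(1) by (auto simp: curves_between_def)
      have "d z v + d v w < D" using g(2)[OF v] d_triangle[OF vX zy(2) AX[OF zy(3)]] by linarith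
      then show "v \<in> S" using vX zy by (auto simp: S_def)
    qed
    then show ?thesis using g(1) unfolding path_component_def curves_between_def by blast
  qed
  have "path_component S z0 z" if "(z0, z) \<in> R\<^sup>*" for z
    using that
  proof induction
    case base
    show ?case using z0K KS by (auto intro: path_component_refl)
  next
    case (step y y')
    then obtain w where w: "w \<in> A" "d y w < D" "d y' w < D" by (auto simp: R_def)
    have "y \<in> K" "y' \<in> K" using step reachK by (auto intro: rtrancl_into_rtrancl)
    then have "path_component S y w" "path_component S y' w"
      using w AX[OF w(1)] d_refl[OF AX[OF w(1)]] by (auto intro!: to_K[of _ w w])
    then show ?case using step.IH path_component_trans path_component_sym by metis
  qed
  then have "path_component S z0 y" if "y \<in> S" for y
    using that to_K unfolding S_def K_def by (fastforce intro: path_component_trans)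
  then have Sconn: "path_connected S"
    unfolding path_connected_component by (meson path_component_sym path_component_trans)
  have far: "t - D < d a s" "d a b - t - \<delta> - D < d b s" if "s \<in> S" for s
  proof -
    obtain w z where w: "w \<in> A" "d z s + d s w < D" "s \<in> Xt" using \<open>s \<in> S\<close> by (auto simp: S_def)
    note wX = AX[OF w(1)]
    have "d s w < D" using w d_nonneg[of z s] by linarith
    moreover have "d a w \<le> d a s + d s w" "d b w \<le> d b s + d s w" "d a b \<le> d a w + d w b"
      using d_triangle X w wX by auto
    moreover have "t \<le> d a w" "d a w \<le> t + \<delta>" using w by (auto simp: A_def)
    ultimately show "t - D < d a s" "d a b - t - \<delta> - D < d b s" using d_sym[of w b] by linarith+
  qed
  have size: "d z0 s < 2 * D * card K - D" if "s \<in> S" for s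
  proof -
    obtain w z where w: "z \<in> K" "d z s + d s w < D" "s \<in> Xt" using \<open>s \<in> S\<close> by (auto simp: S_def)
    have "d z0 s \<le> d z0 z + d z s" using w z0K KF FX by (intro d_triangle) auto
    then show ?thesis using bound[OF w(1)] w(2) d_nonneg[of s w] by (simp add: algebra_simps)
  qed
  have z0F: "z0 \<in> fibre x" using z0K KF by blast
  have move: "d c (deck z0 c s) < 2 * D * card K - D" "deck z0 c s \<in> Xt" if "s \<in> S" "c \<in> fibre x" for s c
  proof -
    have c: "z0 \<in> Xt" "c \<in> Xt" "\<rho> c = \<rho> z0" using that z0F by (auto simp: fibre_def)
    show "d c (deck z0 c s) < 2 * D * card K - D"
      using deck_contracts[OF c c(1), of s] deck_base[OF c] size[OF that(1)] that(1) SX by auto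
    show "deck z0 c s \<in> Xt" using deck_mem[OF c] that(1) SX by blast
  qed
  show ?thesis
  proof (rule that[OF KF Kpos])
    fix z assume z: "z \<in> K"
    then obtain w where w: "w \<in> A" "d z w < D" using near_K by blast
    have "z \<in> Xt" using z KF FX by auto
    then show "t - D < d a z \<and> d a z < t + \<delta> + D"
      using d_triangle[of a z w] d_triangle[of a w z] X AX[OF w(1)] w d_sym[of w z] by (auto simp: A_def)
  next
    show "\<not> (2 * D * card K + \<delta> \<le> t \<and> 2 * D * card K + \<delta> \<le> d a b - t - \<delta>)"
    proof
      assume small: "2 * D * card K + \<delta> \<le> t \<and> 2 * D * card K + \<delta> \<le> d a b - t - \<delta>"
      \<comment> \<open>The triangle inequality leaves
        \<open>(t - D) - (2 * D * card K - D)\<close>, where \<open>D\<close> cancels and the rest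
        is at least \<open>\<delta>\<close> by \<open>small\<close>.\<close>
      have "\<delta> \<le> d s (deck z0 a s')" if "s \<in> S" "s' \<in> S" for s s'
        using far(1)[OF that(1)] move[OF that(2) a] d_triangle[of a "deck z0 a s'" s] X SX that small
          d_sym[of s "deck z0 a s'"] by auto
      moreover have "\<delta> \<le> d s (deck z0 b s')" if "s \<in> S" "s' \<in> S" for s s'
        using far(2)[OF that(1)] move[OF that(2) b] d_triangle[of b "deck z0 b s'" s] X SX that small
          d_sym[of s "deck z0 b s'"] by auto
      moreover have "path_image g \<inter> S \<noteq> {}" if "g \<in> curves_between Xt a b" for g
        using sep[OF that] AS by blast
      ultimately show False
        using no_small_separator[OF F a b z0F _ SX Sconn _ \<delta>] z0K KS by blast
    qed
  qed
qed

text \<open>At level \<open>j * E\<close> the class found by \<open>slab_piece\<close> lies at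
  distances from \<open>a\<close> between \<open>j * E - D\<close> and
  \<open>(j + 1) * E - D\<close>. Different levels therefore use different fibre points, and their
  numbers can be added.\<close>

lemma level_count:
  fixes M :: nat
  assumes F: "finite (fibre x)" and a: "a \<in> fibre x" and b: "b \<in> fibre x"
    and near: "\<And>y. y \<in> Xt \<Longrightarrow> \<exists>z\<in>fibre x. d z y < D"
    and \<delta>: "\<delta> > 0" and L: "(real M - 1) * (2 * D + \<delta>) + \<delta> \<le> d a b"
  shows "M * (M + 2) \<le> 4 * card (fibre x)"
proof -
  define E where "E = 2 * D + \<delta>"
  have "D > 0" using near[of a] a d_nonneg by (auto simp: fibre_def intro: le_less_trans)
  then have E: "E > 0" using \<delta> by (simp add: E_def)
  have "\<exists>K. K \<subseteq> fibre x \<and> (\<forall>z\<in>K. j * E - D < d a z \<and> d a z < j * E + \<delta> + D) \<and> min (j + 1) (M - j) \<le> card K"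
    if j: "j < M" for j
  proof -
    have "j * E \<le> (real M - 1) * E" using j E by (intro mult_right_mono) auto
    then have "0 \<le> j * E" "j * E + \<delta> \<le> d a b" using E L[folded E_def] by (simp, linarith)
    then obtain K where K: "K \<subseteq> fibre x" "card K \<ge> 1"
      "\<And>z. z \<in> K \<Longrightarrow> j * E - D < d a z \<and> d a z < j * E + \<delta> + D"
      "\<not> (2 * D * card K + \<delta> \<le> j * E \<and> 2 * D * card K + \<delta> \<le> d a b - j * E - \<delta>)"
      using slab_piece[OF F a b near _ \<delta>, of "j * E"] by metis
    have "\<not> card K < min (j + 1) (M - j)"
    proof
      assume k: "card K < min (j + 1) (M - j)"
      \<comment> \<open>Each unit of \<open>card K\<close> brings its own \<open>\<delta>\<close>,
        and one of them covers the extra \<open>\<delta>\<close>. By \<open>k\<close>,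
        \<open>card K\<close> is at most \<open>j\<close> and at most
        \<open>M - 1 - j\<close>.\<close>
      have "2 * D * card K + \<delta> \<le> card K * E"
        using K(2) \<delta> mult_right_mono[of 1 "real (card K)" \<delta>] by (simp add: E_def algebra_simps)
      moreover have "card K * E \<le> j * E" using k E by (intro mult_right_mono) auto
      moreover have "card K * E \<le> (real M - 1 - j) * E" using k E by (intro mult_right_mono) auto
      ultimately show False using K(4) L by (simp add: E_def algebra_simps)
    qed
    then show ?thesis using K by (intro exI[of _ K]) auto
  qed
  then obtain K where K: "\<And>j. j < M \<Longrightarrow> K j \<subseteq> fibre x"
    "\<And>j z. j < M \<Longrightarrow> z \<in> K j \<Longrightarrow> j * E - D < d a z \<and> d a z < j * E + \<delta> + D"
    "\<And>j. j < M \<Longrightarrow> min (j + 1) (M - j) \<le> card (K j)" by metis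
  have less: "K i \<inter> K j = {}" if "i < j" "j < M" for i j
  proof -
    have "(real i + 1) * E \<le> j * E" using that E by (intro mult_right_mono) auto
    then show ?thesis using K(2)[of i] K(2)[of j] that by (force simp: E_def algebra_simps)
  qed
  have "(\<Sum>j<M. min (j + 1) (M - j)) \<le> (\<Sum>j<M. card (K j))" using K(3) by (intro sum_mono) auto
  also have "\<dots> = card (\<Union>j<M. K j)"
  proof (rule card_UN_disjoint[symmetric])
    show "\<forall>i\<in>{..<M}. \<forall>j\<in>{..<M}. i \<noteq> j \<longrightarrow> K i \<inter> K j = {}"
      using less by (metis Int_commute lessThan_iff linorder_neqE_nat)
  qed (use K(1) F in \<open>auto intro: finite_subset\<close>)
  also have "\<dots> \<le> card (fibre x)" using K(1) F by (intro card_mono) auto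
  finally show ?thesis using sum_min_triangular[of M] by linarith
qed

lemma fibre_points_distance:
  assumes X: "compact X" and F: "finite (fibre x)" and a: "a \<in> fibre x" and b: "b \<in> fibre x"
    and M: "4 * card (fibre x) < M * (M + 2)"
  shows "d a b \<le> 2 * (real M - 1) * diameter X"
proof (rule ccontr)
  assume "\<not> d a b \<le> 2 * (real M - 1) * diameter X"
  then have gt: "2 * (real M - 1) * diameter X < d a b" by simp
  have M1: "real M - 1 \<ge> 0" using M by (cases M) auto
  define r where "r = d a b - 2 * (real M - 1) * diameter X"
  \<comment> \<open>\<open>level_count\<close> will be used with
    \<open>diameter X + \<epsilon>\<close> for \<open>D\<close> and \<open>\<epsilon>\<close> for
    \<open>\<delta>\<close>; this costs \<open>(3 * M - 2) * \<epsilon>\<close>, less than the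
    surplus \<open>r\<close>.\<close>
  define \<epsilon> where "\<epsilon> = r / (3 * real M)"
  have "r > 0" using gt by (simp add: r_def)
  then have \<epsilon>: "\<epsilon> > 0" "3 * real M * \<epsilon> = r" using M1 by (auto simp: \<epsilon>_def)
  have x: "x \<in> X" using a onto by (auto simp: fibre_def)
  have "\<exists>z\<in>fibre x. d z y < diameter X + \<epsilon>" if y: "y \<in> Xt" for y
  proof -
    have "dist (\<rho> y) x \<le> diameter X"
      using X x y onto by (intro diameter_bounded_bound compact_imp_bounded) auto
    then have "dist (\<rho> y) x < diameter X + \<epsilon>" using \<epsilon> by simp
    then obtain z where "z \<in> Xt" "\<rho> z = x" "d y z < diameter X + \<epsilon>"
      using near_fibre_point[OF y x] by metis
    then show ?thesis using d_sym[of y z] by (auto simp: fibre_def)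
  qed
  moreover have "(real M - 1) * (2 * (diameter X + \<epsilon>) + \<epsilon>) + \<epsilon> \<le> d a b"
    using \<epsilon> M1 unfolding r_def by (simp add: algebra_simps)
  ultimately have "M * (M + 2) \<le> 4 * card (fibre x)" using level_count[OF F a b _ \<epsilon>(1)] by blast
  then show False using M by simp
qed

text \<open>Use the fibre through \<open>p\<close>: only \<open>q\<close> has to be moved to a fibre
  point, at the cost of about one diameter.\<close>

lemma distance_bound:
  assumes X: "compact X" and x0: "x0 \<in> X" "finite (fundamental_group_set X x0)"
    and p: "p \<in> Xt" and q: "q \<in> Xt"
  shows "d p q \<le> (2 * sqrt (4 * real (card (fundamental_group_set X x0)) + 1) - 1) * diameter X"
proof -
  define n where "n = card (fundamental_group_set X x0)"
  define x where "x = \<rho> p"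
  have x: "x \<in> X" using p onto by (auto simp: x_def)
  have F: "finite (fibre x)" "card (fibre x) \<le> n" using fibre_card[OF x0 x] by (auto simp: n_def)
  \<comment> \<open>Minimality gives \<open>(M - 1) * (M + 1) \<le> 4 * n\<close>, that is
    \<open>M ^ 2 \<le> 4 * n + 1\<close>.\<close>
  define M where "M = (LEAST M. 4 * n < M * (M + 2))"
  have "4 * n < (4 * n + 1) * (4 * n + 1 + 2)" by (simp add: algebra_simps)
  then have M: "4 * n < M * (M + 2)" unfolding M_def by (rule LeastI)
  then obtain m where m: "M = Suc m" by (cases M) auto
  have "\<not> 4 * n < m * (m + 2)" using m not_less_Least[of m "\<lambda>M. 4 * n < M * (M + 2)"] by (simp add: M_def)
  then have "M ^ 2 \<le> 4 * n + 1" by (simp add: m power2_eq_square algebra_simps)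
  then have "real (M ^ 2) \<le> real (4 * n + 1)" by (rule of_nat_mono)
  then have Ms: "real M \<le> sqrt (4 * real n + 1)" by (intro real_le_rsqrt) simp
  have dx: "dist (\<rho> q) x \<le> diameter X"
    using X x q onto by (intro diameter_bounded_bound compact_imp_bounded) auto
  have pF: "p \<in> fibre x" using p by (simp add: fibre_def x_def)
  have D: "diameter X \<ge> 0" using X by (intro diameter_ge_0 compact_imp_bounded)
  have "d p q \<le> 2 * (real M - 1) * diameter X + diameter X"
  proof (rule field_le_epsilon)
    fix e :: real assume "e > 0"
    then have "dist (\<rho> q) x < diameter X + e" using dx by simp
    then obtain z where z: "z \<in> Xt" "\<rho> z = x" "d q z < diameter X + e" using near_fibre_point[OF q x] by metis
    have "d p z \<le> 2 * (real M - 1) * diameter X"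
      using fibre_points_distance[OF X F(1) pF, of z M] z F(2) M by (simp add: fibre_def)
    then show "d p q \<le> 2 * (real M - 1) * diameter X + diameter X + e"
      using d_triangle[OF p z(1) q] z(3) d_sym[of q z] by linarith
  qed
  also have "\<dots> = (2 * real M - 1) * diameter X" by (simp add: algebra_simps)
  also have "\<dots> \<le> (2 * sqrt (4 * real n + 1) - 1) * diameter X"
    using Ms D by (intro mult_right_mono) auto
  finally show ?thesis by (simp add: n_def)
qed

end

section \<open>From the bound on distances to the strict bound on the diameter\<close>

theorem theorem2:
  fixes X :: "'a::metric_space set"
    and Xt :: "'b::topological_space set"
    and \<rho> :: "'b \<Rightarrow> 'a"
    and x0 :: 'a
    and n :: nat
  assumes "compact X"
    and "length_space X"
    and "diameter X > 0"
    and "universal_cover Xt \<rho> X"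
    and "x0 \<in> X"
    and "finite (fundamental_group_set X x0)"
    and "card (fundamental_group_set X x0) = n"
  shows "lifted_diameter Xt \<rho> < ereal (4 * sqrt (real n) * diameter X)"
proof -
  interpret length_cover X Xt \<rho>
    using assms by unfold_locales (auto simp: universal_cover_def)
  have "lifted_diameter Xt \<rho> \<le> ereal ((2 * sqrt (4 * real n + 1) - 1) * diameter X)"
    unfolding lifted_diameter_def
  proof (rule SUP_least, clarify)
    fix p q assume pq: "p \<in> Xt" "q \<in> Xt"
    show "lifted_dist Xt \<rho> p q \<le> ereal ((2 * sqrt (4 * real n + 1) - 1) * diameter X)"
      using distance_bound[OF assms(1,5,6) pq] assms(7) unfolding ereal_d[OF pq, symmetric] by simp
  qed
  also have "\<dots> < ereal (4 * sqrt (real n) * diameter X)"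
  proof -
    \<comment> \<open>The class of the constant loop gives \<open>n \<ge> 1\<close>, needed for the
      strict inequality below.\<close>
    have "curves_between X x0 x0 \<noteq> {}" using curves_between_const[OF assms(5)] by blast
    then have "n \<ge> 1"
      using assms(6,7) by (auto simp: fundamental_group_set_def Suc_le_eq card_gt_0_iff)
    then have s: "1 \<le> sqrt (real n)" by simp
    have sq: "(4 * sqrt (real n) + 1)\<^sup>2 = 16 * real n + 8 * sqrt (real n) + 1"
      by (simp add: power2_sum power_mult_distrib)
    \<comment> \<open>To be read with \<open>u = sqrt n\<close> and \<open>v = n\<close>: comparing
      squares, \<open>16 * n + 8 * sqrt n + 1\<close> exceeds \<open>16 * n + 4\<close>.\<close>
    have "1 \<le> u \<Longrightarrow> 4 * (4 * v + 1) < 16 * v + 8 * u + 1" for u v :: real by simp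
    from this[OF s] have "4 * (4 * real n + 1) < (4 * sqrt (real n) + 1)\<^sup>2" unfolding sq .
    then have "sqrt (4 * (4 * real n + 1)) < 4 * sqrt (real n) + 1"
      using s by (intro real_less_lsqrt) auto
    moreover have "sqrt (4 * (4 * real n + 1)) = 2 * sqrt (4 * real n + 1)" by (subst real_sqrt_mult) simp
    ultimately have "2 * sqrt (4 * real n + 1) - 1 < 4 * sqrt (real n)" by linarith
    then show ?thesis using assms(3) by simp
  qed
  finally show ?thesis .
qed

end
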